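(* Assume that $h$ is not identically zero, and that $\varepsilon>0$. Then there is no $\lambda\in\mathbb{R}$ such that $\mathbf{E}_\varepsilon$ is $\lambda$-convex along geodesics in $[\mathcal{P}_2^r(\mathbb{R}^d)]^2$. More specifically, there is a constant $C>0$ such that for each $\omega\in(0,\infty)$ there are functions $u^\omega,v^\omega\in\mathcal{P}_2^r(\mathbb{R}^d)\cap C^\infty(\mathbb{R}^d)$ with $$\frac{\mathrm{d}^2}{\mathrm{d}s^2}\bigg|_{s=0}\int_{\mathbb{R}^d}H_\varepsilon(T_s\#u^\omega,v^\omega)\,\mathrm{d}x\le-C(\omega-1),$$ where $T_s$ is the translation by $s\ge0$ in $x_1$-direction, i.e. $T_s(x)=x+s\mathbf{e}_1$.
   Context: $\mathbb{R}_{>0}=(0,\infty)$, $\mathbb{R}_{\ge0}=[0,\infty)$, $\mathbf 1$ is the $d\times d$ identity matrix, $\mathbf{e}_1$ the first unit vector. $\mathcal{P}_2^r(\mathbb{R}^d)$ is the set of probability densities $u:\mathbb{R}^d\to\mathbb{R}_{\ge0}$ of finite second moment, $\mathbf{W}_2$ is the $L^2$-Wasserstein distance on it; $[\mathcal{P}_2^r(\mathbb{R}^d)]^2$ carries the metric $\widetilde{\mathbf W}_2((u,v),(\hat u,\hat v))=\sqrt{\mathbf{W}_2(u,\hat u)^2+\mathbf{W}_2(v,\hat v)^2}$. $T\#u$ denotes the density of the push-forward under $T$ of the measure with density $u$. A functional $\mathbf F$ on $[\mathcal{P}_2^r(\mathbb{R}^d)]^2$ is $\lambda$-convex along geodesics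 if for every geodesic $(w_s)_{s\in[0,1]}$ (constant-speed, minimizing) the function $s\mapsto\mathbf F(w_s)+\frac\lambda2s(1-s)\widetilde{\mathbf W}_2(w_0,w_1)^2$ is convex on $[0,1]$. Standing assumptions. (Potentials) $\Phi,\Psi\in C^\infty(\mathbb{R}^d)$; there are constants $\Lambda,M>0$ with $\Lambda\mathbf 1\le\nabla^2\Phi\le M\mathbf 1$ and $\Lambda\mathbf 1\le\nabla^2\Psi\le M\mathbf 1$; and $0=\inf\Phi=\Phi(\underline x_\Phi)$, $0=\inf\Psi=\Psi(\underline x_\Psi)$ for some points $\underline x_\Phi,\underline x_\Psi\in\mathbb{R}^d$. (Nonlinearities) $F,G\in C^\infty(\mathbb{R}_{>0})\cap C^1(\mathbb{R}_{\ge0})$ with $F''(r)>0$, $G''(r)>0$ for all $r>0$; $\liminf_{r\to\infty}F''(r)>0$, $\liminf_{r\to\infty}G''(r)>0$; $F(0)=G(0)=0$, $F'(0)=G'(0)=0$; there are exponents $m,n\ge2$ with $\lim_{r\downarrow0}r^{-(m-2)}F''(r)\in(0,\infty)$ and $\lim_{r\downarrow0}r^{-(n-2)}G''(r)\in(0,\infty)$; McCann's condition $rF'(r)\le F(r)+r^2F''(r)$, $rG'(r)\le G(r)+r^2G''(r)$ for all $r>0$; and the doubling condition: for some constant $D$, $F(r+s)\le D(1+F(r)+F(s))$ and $G(r+s)\le D(1+G(r)+G(s))$ for all $r,s>0$. (Coupling) $h\in C^\infty(\mathbb{R}_{>0}^2)\cap C^1(\mathbb{R}_{\ge0}^2)$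 with $h=\partial_uh=\partial_vh\equiv0$ on $\partial\mathbb{R}_{\ge0}^2$; there is $\varepsilon^*>0$ such that $(u,v)\mapsto F(u)+G(v)+2\varepsilon^*h(u,v)$ is convex and $2\varepsilon^*|h(u,v)|\le F(u)+G(v)$ for all $u,v>0$. $H_\varepsilon(u,v)=F(u)+G(v)+\varepsilon h(u,v)$ and $\mathbf{E}_\varepsilon(u,v)=\int_{\mathbb{R}^d}\big[H_\varepsilon(u,v)+u\Phi+v\Psi\big]\,\mathrm{d}x$. *)

theory Defs
  imports "HOL-Analysis.Analysis"
begin

section \<open>Differentiability classes\<close>

text \<open>Intended for open \<open>S\<close> only.\<close>

fun Ck_on :: "nat \<Rightarrow> 'a::euclidean_space set \<Rightarrow> ('a \<Rightarrow> real) \<Rightarrow> bool" where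
  "Ck_on 0 S f \<longleftrightarrow> continuous_on S f"
| "Ck_on (Suc k) S f \<longleftrightarrow>
     (\<forall>x\<in>S. f differentiable (at x)) \<and>
     (\<forall>v. Ck_on k S (\<lambda>x. frechet_derivative f (at x) v))"

definition smooth_on :: "'a::euclidean_space set \<Rightarrow> ('a \<Rightarrow> real) \<Rightarrow> bool" where
  "smooth_on S f \<longleftrightarrow> (\<forall>k. Ck_on k S f)"

text \<open>For a set \<open>S\<close> with boundary, derivatives are taken within \<open>S\<close>. This is used only for
  \<open>{0..}\<close> and the closed quadrant, where derivatives within \<open>S\<close> are unique at every point.\<close>

definition C1_on :: "'a::euclidean_space set \<Rightarrow> ('a \<Rightarrow> real) \<Rightarrow> bool" where
  "C1_on S f \<longleftrightarrow>
     f differentiable_on S \<and>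
     (\<forall>v. continuous_on S (\<lambda>x. frechet_derivative f (at x within S) v))"

definition hessian :: "('a::euclidean_space \<Rightarrow> real) \<Rightarrow> 'a \<Rightarrow> 'a \<Rightarrow> 'a \<Rightarrow> real" where
  "hessian f x v w = frechet_derivative (\<lambda>y. frechet_derivative f (at y) v) (at x) w"

text \<open>\<open>f\<close> is differentiable on \<open>S\<close> near \<open>x\<close>, with a derivative that is itself differentiable
  at \<open>x\<close>; all derivatives are relative to \<open>S\<close>, hence one-sided at an end point of \<open>S\<close>.\<close>

definition has_second_derivative_within ::
    "(real \<Rightarrow> real) \<Rightarrow> real \<Rightarrow> real \<Rightarrow> real set \<Rightarrow> bool" where
  "has_second_derivative_within f c x S \<longleftrightarrow>
     (\<exists>f' \<delta>. \<delta> > 0 \<and>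
        (\<forall>s\<in>S. \<bar>s - x\<bar> < \<delta> \<longrightarrow> (f has_real_derivative f' s) (at s within S)) \<and>
        (f' has_real_derivative c) (at x within S))"

section \<open>Densities and the Wasserstein distance\<close>

text \<open>Densities are Borel functions, not equivalence classes: everything below depends on
  them only up to Lebesgue null sets.\<close>

definition density_P2 :: "('a::euclidean_space \<Rightarrow> real) set" where
  "density_P2 = {u. u \<in> borel_measurable borel \<and> (\<forall>x. 0 \<le> u x) \<and>
     integrable lborel u \<and> (\<integral>x. u x \<partial>lborel) = 1 \<and>
     integrable lborel (\<lambda>x. (norm x)\<^sup>2 * u x)}"

definition measure_of_density :: "('a::euclidean_space \<Rightarrow> real) \<Rightarrow> 'a measure" where
  "measure_of_density u = density lborel (\<lambda>x. ennreal (u x))"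

definition push_forward ::
    "('a \<Rightarrow> 'a) \<Rightarrow> ('a::euclidean_space \<Rightarrow> real) \<Rightarrow> 'a \<Rightarrow> real" where
  "push_forward T u = (\<lambda>x. enn2real (RN_deriv lborel (distr (measure_of_density u) lborel T) x))"

definition couplings ::
    "('a::euclidean_space \<Rightarrow> real) \<Rightarrow> ('a \<Rightarrow> real) \<Rightarrow> ('a \<times> 'a) measure set" where
  "couplings u v = {\<gamma>. sets \<gamma> = sets borel \<and>
     distr \<gamma> borel fst = measure_of_density u \<and>
     distr \<gamma> borel snd = measure_of_density v}"

definition W2 :: "('a::euclidean_space \<Rightarrow> real) \<Rightarrow> ('a \<Rightarrow> real) \<Rightarrow> real" where
  "W2 u v = sqrt (enn2real
     (INF \<gamma>\<in>couplings u v. \<integral>\<^sup>+ z. ennreal ((dist (fst z) (snd z))\<^sup>2) \<partial>\<gamma>))"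

type_synonym 'a density_pair = "('a \<Rightarrow> real) \<times> ('a \<Rightarrow> real)"

definition W2_pair :: "'a::euclidean_space density_pair \<Rightarrow> 'a density_pair \<Rightarrow> real" where
  "W2_pair p q = sqrt ((W2 (fst p) (fst q))\<^sup>2 + (W2 (snd p) (snd q))\<^sup>2)"

section \<open>Convexity along geodesics\<close>

definition geodesic :: "(real \<Rightarrow> 'a::euclidean_space density_pair) \<Rightarrow> bool" where
  "geodesic w \<longleftrightarrow>
     (\<forall>s\<in>{0..1}. w s \<in> density_P2 \<times> density_P2) \<and>
     (\<forall>s\<in>{0..1}. \<forall>t\<in>{0..1}. W2_pair (w s) (w t) = \<bar>s - t\<bar> * W2_pair (w 0) (w 1))"

text \<open>Note \<open>\<infinity> - \<infinity> = \<infinity>\<close> and \<open>0 * \<infinity> = 0\<close> in \<^typ>\<open>ereal\<close>.\<close>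

definition ereal_convex_on :: "real set \<Rightarrow> (real \<Rightarrow> ereal) \<Rightarrow> bool" where
  "ereal_convex_on S f \<longleftrightarrow>
     (\<forall>x\<in>S. \<forall>y\<in>S. \<forall>t\<in>{0..1}.
        f ((1 - t) * x + t * y) \<le> ereal (1 - t) * f x + ereal t * f y)"

definition convex_along_geodesics ::
    "real \<Rightarrow> ('a::euclidean_space density_pair \<Rightarrow> ereal) \<Rightarrow> bool" where
  "convex_along_geodesics lam E \<longleftrightarrow>
     (\<forall>w. geodesic w \<longrightarrow>
        ereal_convex_on {0..1}
          (\<lambda>s. E (w s) + ereal (lam / 2 * s * (1 - s) * (W2_pair (w 0) (w 1))\<^sup>2)))"

section \<open>The assumptions on potentials, nonlinearities and coupling\<close>

definition potential :: "real \<Rightarrow> real \<Rightarrow> ('a::euclidean_space \<Rightarrow> real) \<Rightarrow> bool" where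
  "potential \<Lambda> M \<Phi> \<longleftrightarrow>
     smooth_on UNIV \<Phi> \<and>
     (\<forall>x v. \<Lambda> * (v \<bullet> v) \<le> hessian \<Phi> x v v \<and> hessian \<Phi> x v v \<le> M * (v \<bullet> v)) \<and>
     (\<exists>x0. \<Phi> x0 = 0 \<and> (\<forall>x. \<Phi> x0 \<le> \<Phi> x))"

text \<open>Only the values of \<open>F\<close> on \<open>{0..}\<close> matter; \<open>m\<close> is the order of degeneracy at \<open>0\<close> and
  \<open>D\<close> the doubling constant.\<close>

definition nonlinearity :: "real \<Rightarrow> real \<Rightarrow> (real \<Rightarrow> real) \<Rightarrow> bool" where
  "nonlinearity D m F \<longleftrightarrow>
     smooth_on {0<..} F \<and> C1_on {0..} F \<and>
     (\<forall>r>0. deriv (deriv F) r > 0) \<and>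
     Liminf at_top (\<lambda>r. ereal (deriv (deriv F) r)) > 0 \<and>
     F 0 = 0 \<and> (F has_real_derivative 0) (at 0 within {0..}) \<and>
     m \<ge> 2 \<and>
     (\<exists>c>0. ((\<lambda>r. r powr (- (m - 2)) * deriv (deriv F) r) \<longlongrightarrow> c) (at_right 0)) \<and>
     (\<forall>r>0. r * deriv F r \<le> F r + r\<^sup>2 * deriv (deriv F) r) \<and>
     (\<forall>r>0. \<forall>s>0. F (r + s) \<le> D * (1 + F r + F s))"

abbreviation quadrant :: "(real \<times> real) set" where
  "quadrant \<equiv> {0..} \<times> {0..}"

definition coupling_term ::
    "real \<Rightarrow> (real \<Rightarrow> real) \<Rightarrow> (real \<Rightarrow> real) \<Rightarrow> (real \<times> real \<Rightarrow> real) \<Rightarrow> bool" where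
  "coupling_term \<epsilon>s F G h \<longleftrightarrow>
     smooth_on ({0<..} \<times> {0<..}) h \<and> C1_on quadrant h \<and>
     (\<forall>p\<in>frontier quadrant.
        h p = 0 \<and>
        frechet_derivative h (at p within quadrant) (1, 0) = 0 \<and>
        frechet_derivative h (at p within quadrant) (0, 1) = 0) \<and>
     \<epsilon>s > 0 \<and>
     convex_on quadrant (\<lambda>(u, v). F u + G v + 2 * \<epsilon>s * h (u, v)) \<and>
     (\<forall>u>0. \<forall>v>0. 2 * \<epsilon>s * \<bar>h (u, v)\<bar> \<le> F u + G v)"

section \<open>The energy\<close>

definition H ::
    "(real \<Rightarrow> real) \<Rightarrow> (real \<Rightarrow> real) \<Rightarrow> (real \<times> real \<Rightarrow> real) \<Rightarrow> real \<Rightarrow> real \<Rightarrow> real \<Rightarrow> real" where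
  "H F G h \<epsilon> u v = F u + G v + \<epsilon> * h (u, v)"

text \<open>Integral with values in \<open>[-\<infinity>, \<infinity>]\<close>, equal to \<open>\<infinity>\<close> whenever the positive part is not
  integrable.\<close>

definition ext_integral :: "('a::euclidean_space \<Rightarrow> real) \<Rightarrow> ereal" where
  "ext_integral f =
     enn2ereal (\<integral>\<^sup>+ x. ennreal (f x) \<partial>lborel) - enn2ereal (\<integral>\<^sup>+ x. ennreal (- f x) \<partial>lborel)"

definition energy ::
    "(real \<Rightarrow> real) \<Rightarrow> (real \<Rightarrow> real) \<Rightarrow> (real \<times> real \<Rightarrow> real) \<Rightarrow>
     ('a::euclidean_space \<Rightarrow> real) \<Rightarrow> ('a \<Rightarrow> real) \<Rightarrow> real \<Rightarrow> 'a density_pair \<Rightarrow> ereal" where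
  "energy F G h \<Phi> \<Psi> \<epsilon> = (\<lambda>(u, v).
     ext_integral (\<lambda>x. H F G h \<epsilon> (u x) (v x) + u x * \<Phi> x + v x * \<Psi> x))"

end

theory Submission
  imports Defs
begin

text \<open>
  Only the coupling \<open>h\<close> feels a translation of \<open>u\<close> relative to \<open>v\<close>, and the second derivative of
  the internal energy is \<open>- \<epsilon> \<integral> h\<^sub>u\<^sub>v(u, v) \<partial>\<^sub>1u \<partial>\<^sub>1v\<close>. As \<open>h\<close> vanishes on the boundary of the quadrant but
  not identically, \<open>h\<^sub>u\<^sub>v\<close> is nonzero near some interior point \<open>(ub, vb)\<close>. There, \<open>u\<close> and \<open>v\<close> are
  plateaus of heights \<open>ub\<close> and \<open>vb\<close> plus multiples of the same rapidly oscillating bump \<open>a\<close>, with signs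
  making the integrand a positive multiple of \<open>(\<partial>\<^sub>1a)\<^sup>2\<close>. The plateau of \<open>v\<close> lies well inside that of
  \<open>u\<close> and contains the support of \<open>a\<close>, so that \<open>h\<close>, which is only \<open>C\<^sup>1\<close> up to the boundary, is
  differentiated twice only where it is smooth; the missing mass is placed far away, separately for
  \<open>u\<close> and \<open>v\<close>, where it does not interact. Raising the frequency makes the second derivative arbitrarily
  negative. Translations are geodesics, and along them the potential energy has second derivative at
  most \<open>M\<close>, so no \<open>\<lambda>\<close> can compensate.
\<close>

section \<open>Smooth cutoff functions\<close>

lemma Ck_SucI:
  fixes f :: "'a::euclidean_space \<Rightarrow> real"
  assumes "\<And>x. (f has_derivative f' x) (at x)" "\<And>v. Ck_on k UNIV (\<lambda>x. f' x v)"
  shows "Ck_on (Suc k) UNIV f"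
proof -
  have "frechet_derivative f (at x) = f' x" for x
    using frechet_derivative_at[OF assms(1)] by simp
  then show ?thesis
    using assms by (auto simp: differentiable_def)
qed

lemma Ck_SucD:
  assumes "Ck_on (Suc k) UNIV f"
  shows "(f has_derivative frechet_derivative f (at x)) (at x)"
    and "Ck_on k UNIV (\<lambda>x. frechet_derivative f (at x) v)"
  using assms by (auto simp: frechet_derivative_works)

text \<open>\<open>Ck_on\<close> does not ask for continuity at intermediate orders, so it has to be
  recovered from differentiability. The product and chain rules need this, because they leave one
  factor undifferentiated.\<close>

lemma Ck_Suc_imp: "Ck_on (Suc k) S f \<Longrightarrow> Ck_on k S f"
proof (induction k arbitrary: f)
  case 0
  then show ?case
    by (auto intro!: continuous_at_imp_continuous_on differentiable_imp_continuous_within)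
next
  case (Suc k)
  then have "\<forall>x\<in>S. f differentiable (at x)"
    "\<And>v. Ck_on (Suc k) S (\<lambda>x. frechet_derivative f (at x) v)" by auto
  with Suc.IH show ?case by simp
qed

lemma Ck_const: "Ck_on k UNIV (\<lambda>x. c)"
proof (induction k arbitrary: c)
  case 0 then show ?case by simp
next
  case (Suc k)
  show ?case by (rule Ck_SucI[where f' = "\<lambda>_ _. 0"]) (auto intro: Suc)
qed

lemma Ck_bounded_linear:
  assumes "bounded_linear f"
  shows "Ck_on k UNIV f"
proof (cases k)
  case 0 then show ?thesis by (simp add: assms linear_continuous_on)
next
  case (Suc k)
  show ?thesis unfolding Suc
    by (rule Ck_SucI[where f' = "\<lambda>_. f"]) (auto intro: Ck_const bounded_linear_imp_has_derivative assms)
qed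

lemma Ck_add:
  assumes "Ck_on k UNIV f" "Ck_on k UNIV g"
  shows "Ck_on k UNIV (\<lambda>x. f x + g x)"
  using assms
proof (induction k arbitrary: f g)
  case 0 then show ?case by (simp add: continuous_on_add)
next
  case (Suc k)
  show ?case
    by (rule Ck_SucI[OF has_derivative_add[OF Ck_SucD(1)[OF Suc.prems(1)] Ck_SucD(1)[OF Suc.prems(2)]]])
       (intro Suc.IH Ck_SucD(2) Suc.prems)
qed

lemma Ck_mult:
  assumes "Ck_on k UNIV f" "Ck_on k UNIV g"
  shows "Ck_on k UNIV (\<lambda>x. f x * g x)"
  using assms
proof (induction k arbitrary: f g)
  case 0 then show ?case by (simp add: continuous_on_mult)
next
  case (Suc k)
  show ?case
    by (rule Ck_SucI[OF has_derivative_mult[OF Ck_SucD(1)[OF Suc.prems(1)] Ck_SucD(1)[OF Suc.prems(2)]]])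
       (intro Ck_add Suc.IH Ck_SucD(2) Suc.prems Ck_Suc_imp[of k])
qed

text \<open>The inner function is real-valued, so the chain rule gives a product of two scalar
  functions and the induction closes by \<open>Ck_mult\<close>.\<close>

lemma Ck_compose:
  fixes g :: "real \<Rightarrow> real"
  assumes "Ck_on k UNIV g" "Ck_on k UNIV f"
  shows "Ck_on k UNIV (\<lambda>x. g (f x))"
  using assms
proof (induction k arbitrary: f g)
  case 0 then show ?case by (auto intro: continuous_on_compose2)
next
  case (Suc k)
  have lin: "frechet_derivative g (at y) w = w * frechet_derivative g (at y) 1" for y w
    using linear_cmul[OF has_derivative_linear[OF Ck_SucD(1)[OF Suc.prems(1), of y]], of w 1] by simp
  have "((\<lambda>x. g (f x)) has_derivative
      (\<lambda>v. frechet_derivative f (at x) v * frechet_derivative g (at (f x)) 1)) (at x)" for x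
    using has_derivative_compose[OF Ck_SucD(1)[OF Suc.prems(2)] Ck_SucD(1)[OF Suc.prems(1)], of x]
    by (subst (asm) lin)
  then show ?case
    by (rule Ck_SucI)
       (intro Ck_mult Suc.IH[of "\<lambda>y. frechet_derivative g (at y) 1"] Ck_SucD(2) Suc.prems Ck_Suc_imp[of k])
qed

lemma Ck_DERIV_SucI:
  fixes f :: "real \<Rightarrow> real"
  assumes "\<And>x. (f has_real_derivative f' x) (at x)" "Ck_on k UNIV f'"
  shows "Ck_on (Suc k) UNIV f"
  using assms by (intro Ck_SucI[where f' = "\<lambda>x v. f' x * v"])
    (auto simp: has_field_derivative_def intro!: Ck_mult Ck_const)

lemma Ck_sin_cos: "Ck_on k UNIV (sin :: real \<Rightarrow> real) \<and> Ck_on k UNIV (cos :: real \<Rightarrow> real)"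
proof (induction k)
  case 0 then show ?case by (auto intro: continuous_intros)
next
  case (Suc k)
  have "Ck_on k UNIV (\<lambda>x::real. (-1) * sin x)" by (intro Ck_mult Ck_const) (use Suc in auto)
  then show ?case using Suc
    by (auto simp del: Ck_on.simps intro!: Ck_DERIV_SucI[of sin cos] Ck_DERIV_SucI[of cos "\<lambda>x. - sin x"] derivative_eq_intros)
qed

text \<open>The smooth function exp(-1/x), extended by 0, divided by powers of x. Including all
  powers makes the family closed under differentiation, so smoothness follows by induction on the
  order for all \<open>k\<close> at once.\<close>

definition flat :: "nat \<Rightarrow> real \<Rightarrow> real" where
  "flat k x = (if x \<le> 0 then 0 else exp (- (1 / x)) / x ^ k)"

text \<open>With y = 1/x this is the decay of y^k exp(-y) at infinity.\<close>

lemma flat_div_tendsto: "((\<lambda>x. exp (- (1 / x)) / x ^ k) \<longlongrightarrow> (0::real)) (at_right 0)"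
proof -
  have "((\<lambda>y. y ^ k / exp y) \<longlongrightarrow> (0::real)) at_top" by (rule tendsto_power_div_exp_0)
  then have "((\<lambda>x. (inverse x) ^ k / exp (inverse x)) \<longlongrightarrow> (0::real)) (at_right 0)"
    by (rule filterlim_compose[OF _ filterlim_inverse_at_top_right])
  moreover have "(inverse x) ^ k / exp (inverse x) = exp (- (1 / x)) / x ^ k" for x :: real
    by (simp add: exp_minus field_simps)
  ultimately show ?thesis by simp
qed

lemma flat_DERIV:
  "(flat k has_real_derivative flat (k + 2) x - k * flat (k + 1) x) (at x)"
proof (cases x "0::real" rule: linorder_cases)
  case less
  have "((\<lambda>x. 0) has_real_derivative 0) (at x)" by simp
  then have "(flat k has_real_derivative 0) (at x)"
    by (rule has_field_derivative_transform_within_open[where S = "{..<0}"])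
       (use less in \<open>auto simp: flat_def\<close>)
  then show ?thesis using less by (simp add: flat_def)
next
  case greater
  have "((\<lambda>x. exp (- (1 / x)) / x ^ k) has_real_derivative
      exp (- (1 / x)) / x ^ (k+2) - k * (exp (- (1 / x)) / x ^ (k+1))) (at x)"
  proof (rule DERIV_cong)
    show "((\<lambda>x. exp (- (1 / x)) / x ^ k) has_real_derivative
        (exp (- (1 / x)) * (1 / x\<^sup>2) * x ^ k - exp (- (1 / x)) * (k * x ^ (k - 1))) / (x ^ k * x ^ k)) (at x)"
      using greater by (intro DERIV_divide DERIV_pow) (auto intro!: derivative_eq_intros simp: power2_eq_square)
  qed (use greater in \<open>cases k; simp add: field_simps power2_eq_square\<close>)
  then have "(flat k has_real_derivative
      exp (- (1 / x)) / x ^ (k+2) - k * (exp (- (1 / x)) / x ^ (k+1))) (at x)"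
    by (rule has_field_derivative_transform_within_open[where S = "{0<..}"])
       (use greater in \<open>auto simp: flat_def\<close>)
  then show ?thesis using greater by (simp add: flat_def)
next
  case equal
  \<comment> \<open>At the origin the right difference quotient is the same expression with exponent
    \<open>Suc k\<close>, and the left one is zero.\<close>
  have "((\<lambda>h. flat k h / h) \<longlongrightarrow> 0) (at_right 0)"
    by (rule Lim_transform_eventually[OF flat_div_tendsto[of "Suc k"]])
       (auto simp: eventually_at_right_field flat_def intro!: exI[of _ 1])
  moreover have "((\<lambda>h. flat k h / h) \<longlongrightarrow> 0) (at_left 0)"
    by (rule Lim_transform_eventually[OF tendsto_const[of 0]])
       (auto simp: eventually_at_left_field flat_def intro!: exI[of _ "-1"])
  ultimately show ?thesis
    using equal by (simp add: DERIV_def flat_def[of _ 0] filterlim_split_at)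
qed

lemma Ck_flat: "Ck_on j UNIV (flat k)"
proof (induction j arbitrary: k)
  case 0
  then show ?case by (auto intro!: continuous_at_imp_continuous_on DERIV_isCont[OF flat_DERIV])
next
  case (Suc j)
  have "Ck_on j UNIV (\<lambda>x. flat (k + 2) x + (- real k) * flat (k + 1) x)"
    by (intro Ck_add Ck_mult Ck_const Suc)
  then show ?case by (intro Ck_DERIV_SucI[OF flat_DERIV]) simp
qed

section \<open>Smooth functions, their derivatives along lines, and supports\<close>

lemma smooth_on_const: "smooth_on UNIV (\<lambda>x. c)"
  by (simp add: smooth_on_def Ck_const)

lemma smooth_on_add: "smooth_on UNIV f \<Longrightarrow> smooth_on UNIV g \<Longrightarrow> smooth_on UNIV (\<lambda>x. f x + g x)"
  by (simp add: smooth_on_def Ck_add)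

lemma smooth_on_mult: "smooth_on UNIV f \<Longrightarrow> smooth_on UNIV g \<Longrightarrow> smooth_on UNIV (\<lambda>x. f x * g x)"
  by (simp add: smooth_on_def Ck_mult)

lemma smooth_on_compose:
  fixes g :: "real \<Rightarrow> real"
  shows "smooth_on UNIV g \<Longrightarrow> smooth_on UNIV f \<Longrightarrow> smooth_on UNIV (\<lambda>x. g (f x))"
  by (simp add: smooth_on_def Ck_compose)

lemma smooth_on_inner: "smooth_on UNIV (\<lambda>x. x \<bullet> c)"
  by (simp add: smooth_on_def Ck_bounded_linear bounded_linear_inner_left)

lemma smooth_on_inner_self: "smooth_on UNIV (\<lambda>x::'a::euclidean_space. x \<bullet> x)"
  unfolding smooth_on_def
proof
  fix k show "Ck_on k UNIV (\<lambda>x::'a. x \<bullet> x)"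
  proof (cases k)
    case 0 then show ?thesis by (auto intro: continuous_intros)
  next
    case (Suc j)
    show ?thesis unfolding Suc
    proof (rule Ck_SucI)
      show "((\<lambda>x::'a. x \<bullet> x) has_derivative (\<lambda>v. x \<bullet> v + x \<bullet> v)) (at x)" for x
        by (auto intro!: derivative_eq_intros simp: inner_commute)
    qed (intro Ck_add Ck_bounded_linear bounded_linear_inner_left)
  qed
qed

text \<open>The inner map is vector-valued here, so \<open>Ck_compose\<close> does not apply; the
  derivative of a translate is the translate of the derivative.\<close>

lemma Ck_shift: "Ck_on k UNIV f \<Longrightarrow> Ck_on k UNIV (\<lambda>x. f (x - c))"
proof (induction k arbitrary: f)
  case 0
  then show ?case by (auto intro!: continuous_on_compose2[of UNIV f] continuous_intros)
next
  case (Suc k)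
  have "((\<lambda>x. f (x - c)) has_derivative frechet_derivative f (at (x - c))) (at x)" for x
  proof -
    have "((\<lambda>x. x - c) has_derivative (\<lambda>v. v)) (at x)" by (auto intro!: derivative_eq_intros)
    from has_derivative_compose[OF this Ck_SucD(1)[OF Suc.prems]] show ?thesis .
  qed
  then show ?case
    by (rule Ck_SucI) (intro Suc.IH[of "\<lambda>x. frechet_derivative f (at x) v" for v] Ck_SucD(2) Suc.prems)
qed

lemma smooth_on_shift: "smooth_on UNIV f \<Longrightarrow> smooth_on UNIV (\<lambda>x. f (x - c))"
  by (simp add: smooth_on_def Ck_shift)

lemma smooth_onD:
  assumes "smooth_on UNIV f"
  shows "(f has_derivative frechet_derivative f (at x)) (at x)"
    and "smooth_on UNIV (\<lambda>x. frechet_derivative f (at x) v)"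
  using assms Ck_SucD[of _ f] unfolding smooth_on_def by blast+

lemma smooth_on_imp_continuous: "smooth_on UNIV f \<Longrightarrow> continuous_on UNIV f"
  using Ck_on.simps(1) unfolding smooth_on_def by blast

lemma smooth_on_DERIV_line:
  assumes "smooth_on UNIV f"
  shows "((\<lambda>s. f (x + s *\<^sub>R e)) has_real_derivative frechet_derivative f (at (x + s *\<^sub>R e)) e) (at s)"
proof -
  note D = smooth_onD(1)[OF assms]
  have "((\<lambda>s. x + s *\<^sub>R e) has_derivative (\<lambda>t. t *\<^sub>R e)) (at s)"
    by (auto intro!: derivative_eq_intros)
  from has_derivative_compose[OF this D]
  have "((\<lambda>s. f (x + s *\<^sub>R e)) has_derivative
      (\<lambda>t. frechet_derivative f (at (x + s *\<^sub>R e)) (t *\<^sub>R e))) (at s)" .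
  moreover have "frechet_derivative f (at y) (t *\<^sub>R e) = frechet_derivative f (at y) e * t" for y t
    using linear_cmul[OF has_derivative_linear[OF D], of _ t e] by simp
  ultimately show ?thesis by (simp add: has_field_derivative_def)
qed

text \<open>The strict inequality puts \<open>x\<close> into the open complement of
  \<open>cball 0 R\<close>, where \<open>f\<close> agrees with 0 in a neighbourhood.\<close>

lemma frechet_derivative_outside_support:
  fixes f :: "'a::euclidean_space \<Rightarrow> real"
  assumes "\<And>x. R \<le> norm x \<Longrightarrow> f x = 0" and "R < norm x"
  shows "frechet_derivative f (at x) v = 0"
proof -
  have "((\<lambda>x. 0) has_derivative (\<lambda>_. 0)) (at x)" by simp
  then have "(f has_derivative (\<lambda>_. 0)) (at x)"
    by (rule has_derivative_transform_within_open[where s = "- cball 0 R"]) (use assms in auto)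
  from frechet_derivative_at[OF this] show ?thesis by metis
qed

text \<open>Nesting the flat function in itself gives a function that is constant on both sides
  without dividing by a non-constant function.\<close>

definition step :: "real \<Rightarrow> real" where
  "step t = flat 0 (flat 0 1 + (-1) * flat 0 t) * (1 / flat 0 (flat 0 1))"

lemma smooth_step: "smooth_on UNIV step"
proof -
  have "smooth_on UNIV (flat 0)" by (simp add: smooth_on_def Ck_flat)
  then show ?thesis unfolding step_def
    by (intro smooth_on_mult smooth_on_compose[of "flat 0" "\<lambda>t. flat 0 1 + (-1) * flat 0 t"]
        smooth_on_add smooth_on_const)
qed

lemma flat_mono: "x \<le> y \<Longrightarrow> flat 0 x \<le> flat 0 y"
  by (auto simp: flat_def field_simps)

lemma flat_pos: "0 < x \<Longrightarrow> 0 < flat 0 x" and flat_nonneg: "0 \<le> flat 0 x"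
  by (auto simp: flat_def)

lemma step_le_0: "t \<le> 0 \<Longrightarrow> step t = 1"
  using flat_pos[OF flat_pos[of 1]] by (simp add: step_def) (simp add: flat_def[of 0 t])

lemma step_ge_1: "1 \<le> t \<Longrightarrow> step t = 0"
  using flat_mono[of 1 t] by (simp add: step_def flat_def[of 0 "_ - _"])

lemma step_bounds: "0 \<le> step t" "step t \<le> 1"
  using flat_pos[OF flat_pos[of 1]] flat_nonneg flat_mono[of "flat 0 1 - flat 0 t" "flat 0 1"]
  by (auto simp: step_def)

text \<open>A radial plateau: for \<open>0 \<le> a < b\<close> it is 1 up to radius \<open>a\<close>
  and 0 from radius \<open>b\<close> on. Using the squared norm keeps it smooth at the
  origin.\<close>

definition cutoff :: "real \<Rightarrow> real \<Rightarrow> 'a::euclidean_space \<Rightarrow> real" where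
  "cutoff a b x = step ((x \<bullet> x + (- a\<^sup>2)) * (1 / (b\<^sup>2 - a\<^sup>2)))"

lemma smooth_cutoff: "smooth_on UNIV (cutoff a b)"
  unfolding cutoff_def
  by (intro smooth_on_compose[OF smooth_step] smooth_on_mult smooth_on_add smooth_on_const
      smooth_on_inner_self)

lemma cutoff_bounds: "0 \<le> cutoff a b x" "cutoff a b x \<le> 1"
  by (auto simp: cutoff_def step_bounds)

lemma cutoff_eq_1:
  assumes "0 \<le> a" "a < b" "norm x \<le> a"
  shows "cutoff a b x = 1"
proof -
  have "a\<^sup>2 < b\<^sup>2" using assms by (intro power_strict_mono) auto
  moreover have "x \<bullet> x \<le> a\<^sup>2" using assms by (simp add: dot_square_norm power_mono)
  ultimately show ?thesis unfolding cutoff_def by (intro step_le_0) (simp add: field_simps)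
qed

lemma cutoff_eq_0:
  assumes "0 \<le> a" "a < b" "b \<le> norm x"
  shows "cutoff a b x = 0"
proof -
  have "a\<^sup>2 < b\<^sup>2" using assms by (intro power_strict_mono) auto
  moreover have "b\<^sup>2 \<le> x \<bullet> x" using assms by (simp add: dot_square_norm power_mono)
  ultimately show ?thesis unfolding cutoff_def by (intro step_ge_1) (simp add: field_simps)
qed

section \<open>Translates of densities\<close>

lemma integrable_continuous_bounded_support:
  fixes f :: "'a::euclidean_space \<Rightarrow> real"
  assumes "continuous_on UNIV f" and "\<And>x. R < norm x \<Longrightarrow> f x = 0"
  shows "integrable lborel f"
proof -
  have "integrable lborel (\<lambda>x. indicator (cball 0 R) x *\<^sub>R f x)"
    by (intro borel_integrable_compact continuous_on_subset[OF assms(1)]) auto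
  moreover have "(\<lambda>x. indicator (cball 0 R) x *\<^sub>R f x) = f"
    using assms(2) by (fastforce simp: indicator_def not_le)
  ultimately show ?thesis by simp
qed

lemma integral_lborel_shift:
  fixes f :: "'a::euclidean_space \<Rightarrow> real"
  assumes [measurable]: "f \<in> borel_measurable borel"
  shows "(\<integral>x. f (x + c) \<partial>lborel) = (\<integral>x. f x \<partial>lborel)"
    and "integrable lborel (\<lambda>x. f (x + c)) \<longleftrightarrow> integrable lborel f"
  using integral_distr[of "(+) c" lborel borel f] integrable_distr_eq[of "(+) c" lborel borel f]
  by (simp_all add: lborel_distr_plus add.commute)

lemma density_P2_measurable: "u \<in> density_P2 \<Longrightarrow> u \<in> borel_measurable borel"
  by (simp add: density_P2_def)

lemma distr_shift_density:
  fixes u :: "'a::euclidean_space \<Rightarrow> real"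
  assumes [measurable]: "u \<in> borel_measurable borel"
  shows "distr (measure_of_density u) borel (\<lambda>x. x + c) = measure_of_density (\<lambda>x. u (x - c))"
proof -
  have "density (distr lborel borel ((+) c)) (\<lambda>x. ennreal (u (x - c)))
      = distr (density lborel (\<lambda>x. ennreal (u (c + x - c)))) borel ((+) c)"
    by (rule density_distr) measurable
  moreover have "(\<lambda>x. x + c) = (+) c" by (auto simp: add.commute)
  ultimately show ?thesis
    by (simp add: measure_of_density_def lborel_distr_plus)
qed

text \<open>\<open>push_forward\<close> is a Radon-Nikodym derivative, hence determined only up to
  null sets; uniqueness of that derivative identifies it with the translated density almost
  everywhere.\<close>

lemma push_forward_shift_AE:
  fixes u :: "'a::euclidean_space \<Rightarrow> real"
  assumes [measurable]: "u \<in> borel_measurable borel" and "\<And>x. 0 \<le> u x"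
  shows "AE x in lborel. push_forward (\<lambda>x. x + c) u x = u (x - c)"
proof -
  \<comment> \<open>The target of \<open>distr\<close> matters only through its sigma-algebra, so
    \<open>lborel\<close> and \<open>borel\<close> give the same measure.\<close>
  have "distr (measure_of_density u) lborel (\<lambda>x. x + c) = measure_of_density (\<lambda>x. u (x - c))"
    unfolding distr_shift_density[OF assms(1), symmetric] by (rule distr_cong) simp_all
  then have "AE x in lborel. ennreal (u (x - c)) =
      RN_deriv lborel (distr (measure_of_density u) lborel (\<lambda>x. x + c)) x"
    by (intro sigma_finite_measure.RN_deriv_unique[OF sigma_finite_lborel]) (simp_all add: measure_of_density_def)
  then show ?thesis
    unfolding push_forward_def
    by eventually_elim (metis assms(2) enn2real_ennreal)
qed

lemma borel_measurable_push_forward [measurable]: "push_forward T u \<in> borel_measurable borel"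
proof -
  have "RN_deriv lborel M \<in> borel_measurable borel" for M :: "'a measure"
    using borel_measurable_RN_deriv[of lborel M] by simp
  then show ?thesis unfolding push_forward_def by measurable
qed

lemma measure_of_density_push_forward:
  fixes u :: "'a::euclidean_space \<Rightarrow> real"
  assumes [measurable]: "u \<in> borel_measurable borel" and "\<And>x. 0 \<le> u x"
  shows "measure_of_density (push_forward (\<lambda>x. x + c) u) = measure_of_density (\<lambda>x. u (x - c))"
  unfolding measure_of_density_def
  by (rule density_cong) (use push_forward_shift_AE[OF assms, of c] in auto)

lemma emeasure_measure_of_density_UNIV:
  assumes "u \<in> density_P2"
  shows "emeasure (measure_of_density u) UNIV = 1"
proof -
  have "emeasure (measure_of_density u) UNIV = (\<integral>\<^sup>+x. ennreal (u x) \<partial>lborel)"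
    using assms by (simp add: measure_of_density_def emeasure_density density_P2_def cong: nn_integral_cong)
  also have "\<dots> = 1"
    using assms by (subst nn_integral_eq_integral) (auto simp: density_P2_def)
  finally show ?thesis .
qed

lemma density_P2D:
  assumes "u \<in> density_P2"
  shows "0 \<le> u x" and "integrable lborel u" and "(\<integral>x. u x \<partial>lborel) = 1"
    and "integrable lborel (\<lambda>x. (norm x)\<^sup>2 * u x)"
  using assms by (simp_all add: density_P2_def)

text \<open>The second moment stays finite because |x + c|^2 is at most 2 |x|^2 + 2 |c|^2.\<close>

lemma density_P2_shift:
  fixes u :: "'a::euclidean_space \<Rightarrow> real"
  assumes "u \<in> density_P2"
  shows "(\<lambda>x. u (x - c)) \<in> density_P2"
proof -
  have [measurable]: "u \<in> borel_measurable borel" using assms density_P2_measurable by blast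
  note u = density_P2D[OF assms]
  have i: "integrable lborel (\<lambda>x. u (x - c))" "(\<integral>x. u (x - c) \<partial>lborel) = 1"
    using integral_lborel_shift[of u "- c"] u(2,3) by simp_all
  have "integrable lborel (\<lambda>x. (norm (x + c))\<^sup>2 * u x)"
  proof (rule Bochner_Integration.integrable_bound)
    show "integrable lborel (\<lambda>x. 2 * ((norm x)\<^sup>2 * u x) + 2 * (norm c)\<^sup>2 * u x)"
      using u(2,4) by simp
    have "(norm (x + c))\<^sup>2 * u x \<le> 2 * ((norm x)\<^sup>2 * u x) + 2 * (norm c)\<^sup>2 * u x" for x
    proof -
      have "(norm (x + c))\<^sup>2 \<le> (norm x + norm c)\<^sup>2" by (intro power_mono norm_triangle_ineq) auto
      also have "\<dots> \<le> 2 * (norm x)\<^sup>2 + 2 * (norm c)\<^sup>2"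
        using sum_squares_bound[of "norm x" "norm c"] by (simp add: power2_sum)
      finally show ?thesis
        using mult_right_mono[OF _ u(1), of "(norm (x + c))\<^sup>2" "2 * (norm x)\<^sup>2 + 2 * (norm c)\<^sup>2"]
        by (simp add: distrib_right mult.assoc)
    qed
    then show "AE x in lborel. norm ((norm (x + c))\<^sup>2 * u x)
        \<le> norm (2 * ((norm x)\<^sup>2 * u x) + 2 * (norm c)\<^sup>2 * u x)"
      using u(1) by (auto simp: abs_mult)
  qed simp
  then have "integrable lborel (\<lambda>x. (norm x)\<^sup>2 * u (x - c))"
    using integral_lborel_shift(2)[of "\<lambda>x. (norm x)\<^sup>2 * u (x - c)" c] by simp
  with i u(1) show ?thesis by (simp add: density_P2_def)
qed

text \<open>All integral conditions transfer from the translated density along the almost everywhere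
  equality. Nonnegativity is required at every point and comes from \<open>enn2real\<close>.\<close>

lemma push_forward_shift_in_density_P2:
  fixes u :: "'a::euclidean_space \<Rightarrow> real"
  assumes u: "u \<in> density_P2"
  shows "push_forward (\<lambda>x. x + c) u \<in> density_P2"
proof -
  have [measurable]: "u \<in> borel_measurable borel" using assms density_P2_measurable by blast
  let ?p = "push_forward (\<lambda>x. x + c) u"
  have ae: "AE x in lborel. ?p x = u (x - c)"
    using u by (intro push_forward_shift_AE) (auto simp: density_P2_def)
  have "integrable lborel ?p \<longleftrightarrow> integrable lborel (\<lambda>x. u (x - c))"
    by (rule integrable_cong_AE) (use ae in auto)
  moreover have "(\<integral>x. ?p x \<partial>lborel) = (\<integral>x. u (x - c) \<partial>lborel)"
    by (rule integral_cong_AE) (use ae in auto)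
  moreover have "integrable lborel (\<lambda>x. (norm x)\<^sup>2 * ?p x) \<longleftrightarrow> integrable lborel (\<lambda>x. (norm x)\<^sup>2 * u (x - c))"
    by (rule integrable_cong_AE) (use ae in auto)
  ultimately show ?thesis
    using density_P2_shift[OF u, of c] by (auto simp: density_P2_def push_forward_def)
qed

text \<open>These means of the two marginals give the lower bound on the transport cost between
  translates. Integrability follows from the finite second moment, as |x . e| is at most |e|^2 +
  |x|^2.\<close>

lemma first_moment_shift:
  fixes u :: "'a::euclidean_space \<Rightarrow> real"
  assumes "u \<in> density_P2"
  shows "integrable (measure_of_density (\<lambda>x. u (x - c))) (\<lambda>x. x \<bullet> e)"
    and "(\<integral>x. x \<bullet> e \<partial>measure_of_density (\<lambda>x. u (x - c))) = (\<integral>x. (x \<bullet> e) * u x \<partial>lborel) + c \<bullet> e"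
proof -
  have [measurable]: "u \<in> borel_measurable borel" using assms density_P2_measurable by blast
  have nn: "0 \<le> u x" for x using assms by (simp add: density_P2_def)
  have m: "integrable lborel (\<lambda>x. (x \<bullet> e) * u x)"
  proof (rule Bochner_Integration.integrable_bound)
    show "integrable lborel (\<lambda>x. (norm e)\<^sup>2 * u x + (norm x)\<^sup>2 * u x)"
      using assms by (simp add: density_P2_def)
    have "\<bar>x \<bullet> e\<bar> * u x \<le> ((norm e)\<^sup>2 + (norm x)\<^sup>2) * u x" for x
    proof (rule mult_right_mono[OF _ nn])
      show "\<bar>x \<bullet> e\<bar> \<le> (norm e)\<^sup>2 + (norm x)\<^sup>2"
        using Cauchy_Schwarz_ineq2[of x e] sum_squares_bound[of "norm x" "norm e"]
          mult_nonneg_nonneg[of "norm x" "norm e"] by simp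
    qed
    then show "AE x in lborel. norm ((x \<bullet> e) * u x) \<le> norm ((norm e)\<^sup>2 * u x + (norm x)\<^sup>2 * u x)"
      using nn by (auto simp: abs_mult distrib_right)
  qed simp
  have m': "integrable lborel (\<lambda>x. ((x + c) \<bullet> e) * u x)"
    using m density_P2D(2,3)[OF assms] by (simp add: inner_add_left distrib_right)
  have eq: "(\<integral>x. ((x + c) \<bullet> e) * u x \<partial>lborel) = (\<integral>x. (x \<bullet> e) * u x \<partial>lborel) + c \<bullet> e"
    using m density_P2D(2,3)[OF assms] by (simp add: inner_add_left distrib_right)
  show "integrable (measure_of_density (\<lambda>x. u (x - c))) (\<lambda>x. x \<bullet> e)"
    using m' integral_lborel_shift(2)[of "\<lambda>x. (x \<bullet> e) * u (x - c)" c] nn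
    unfolding measure_of_density_def by (subst integrable_real_density) (auto simp: mult.commute)
  show "(\<integral>x. x \<bullet> e \<partial>measure_of_density (\<lambda>x. u (x - c))) = (\<integral>x. (x \<bullet> e) * u x \<partial>lborel) + c \<bullet> e"
    using eq integral_lborel_shift(1)[of "\<lambda>x. (x \<bullet> e) * u (x - c)" c] nn
    unfolding measure_of_density_def by (subst integral_real_density) (auto simp: mult.commute)
qed

text \<open>Projecting onto the direction of translation and applying Jensen's inequality shows that no
  coupling beats the translation itself.\<close>

lemma W2_translates:
  fixes u :: "'a::euclidean_space \<Rightarrow> real"
  assumes u: "u \<in> density_P2" and e: "norm e = 1"
    and p: "measure_of_density p = measure_of_density (\<lambda>x. u (x - s *\<^sub>R e))"
    and q: "measure_of_density q = measure_of_density (\<lambda>x. u (x - t *\<^sub>R e))"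
  shows "W2 p q = \<bar>s - t\<bar>"
proof -
  have [measurable]: "u \<in> borel_measurable borel" using assms density_P2_measurable by blast
  have sets_u [measurable_cong, simp]: "sets (measure_of_density u) = sets borel"
    by (simp add: measure_of_density_def)
  have "(INF \<gamma>\<in>couplings p q. \<integral>\<^sup>+ z. ennreal ((dist (fst z) (snd z))\<^sup>2) \<partial>\<gamma>) = ennreal ((s - t)\<^sup>2)"
  proof (rule antisym)
    \<comment> \<open>For the upper bound, both marginals are produced from the same point, so the
      displacement is the constant vector \<open>(s - t) *\<^sub>R e\<close> up to sign.\<close>
    define \<gamma> where "\<gamma> = distr (measure_of_density u) borel (\<lambda>x. (x + s *\<^sub>R e, x + t *\<^sub>R e))"
    have m [measurable]: "(\<lambda>x. (x + s *\<^sub>R e, x + t *\<^sub>R e)) \<in> measure_of_density u \<rightarrow>\<^sub>M borel"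
      unfolding borel_prod[symmetric] by measurable
    have fs: "fst \<in> borel \<rightarrow>\<^sub>M (borel :: 'a measure)" "snd \<in> borel \<rightarrow>\<^sub>M (borel :: 'a measure)"
      by (intro borel_measurable_continuous_onI continuous_intros)+
    have "\<gamma> \<in> couplings p q"
      using distr_shift_density[of u] unfolding couplings_def \<gamma>_def p q
      by (simp add: distr_distr[OF fs(1) m] distr_distr[OF fs(2) m] comp_def)
    moreover have "(\<integral>\<^sup>+ z. ennreal ((dist (fst z) (snd z))\<^sup>2) \<partial>\<gamma>) = ennreal ((s - t)\<^sup>2)"
    proof -
      have "(\<integral>\<^sup>+ z. ennreal ((dist (fst z) (snd z))\<^sup>2) \<partial>\<gamma>)
          = (\<integral>\<^sup>+ x. ennreal ((dist (x + s *\<^sub>R e) (x + t *\<^sub>R e))\<^sup>2) \<partial>measure_of_density u)"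
        unfolding \<gamma>_def
        by (subst nn_integral_distr[OF m])
          (auto intro!: borel_measurable_continuous_onI measurable_compose[OF _ measurable_ennreal] continuous_intros)
      also have "\<dots> = (\<integral>\<^sup>+ x. ennreal ((s - t)\<^sup>2) \<partial>measure_of_density u)"
        using e by (simp add: dist_norm scaleR_left_diff_distrib[symmetric])
      finally show ?thesis by (simp add: emeasure_measure_of_density_UNIV[OF u] sets_eq_imp_space_eq[OF sets_u])
    qed
    ultimately show "(INF \<gamma>\<in>couplings p q. \<integral>\<^sup>+ z. ennreal ((dist (fst z) (snd z))\<^sup>2) \<partial>\<gamma>) \<le> ennreal ((s - t)\<^sup>2)"
      by (rule INF_lower2[OF _ eq_refl])
  next
    show "ennreal ((s - t)\<^sup>2) \<le> (INF \<gamma>\<in>couplings p q. \<integral>\<^sup>+ z. ennreal ((dist (fst z) (snd z))\<^sup>2) \<partial>\<gamma>)"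
    proof (rule INF_greatest)
      fix \<gamma> assume "\<gamma> \<in> couplings p q"
      then have [measurable_cong, simp]: "sets \<gamma> = sets borel"
        and fst: "distr \<gamma> borel fst = measure_of_density (\<lambda>x. u (x - s *\<^sub>R e))"
        and snd: "distr \<gamma> borel snd = measure_of_density (\<lambda>x. u (x - t *\<^sub>R e))"
        by (auto simp: couplings_def p q)
      have [measurable]: "fst \<in> \<gamma> \<rightarrow>\<^sub>M borel" "snd \<in> \<gamma> \<rightarrow>\<^sub>M borel"
        by (auto simp: borel_prod[symmetric] cong: measurable_cong_sets)
      have space [simp]: "space \<gamma> = UNIV" using sets_eq_imp_space_eq[of \<gamma> borel] by simp
      have "emeasure \<gamma> (space \<gamma>) = emeasure (distr \<gamma> borel fst) UNIV"
        by (subst emeasure_distr) auto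
      then have em: "emeasure \<gamma> (space \<gamma>) = 1"
        unfolding fst by (simp add: emeasure_measure_of_density_UNIV density_P2_shift[OF u])
      interpret finite_measure \<gamma> by (rule finite_measureI) (simp add: em[simplified])
      have mm: "measure \<gamma> UNIV = 1" using em by (simp add: measure_def)
      let ?d = "\<lambda>z. (dist (fst z) (snd z))\<^sup>2"
      show "ennreal ((s - t)\<^sup>2) \<le> (\<integral>\<^sup>+ z. ennreal (?d z) \<partial>\<gamma>)"
      \<comment> \<open>Infinite cost makes the bound trivial; finite cost makes the squared
        distance integrable.\<close>
      proof (cases "(\<integral>\<^sup>+ z. ennreal (?d z) \<partial>\<gamma>) = \<infinity>")
        case False
        have int_d: "integrable \<gamma> ?d"
          using False by (intro integrableI_nonneg) (auto simp: less_top)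
        define X where "X z = snd z \<bullet> e - fst z \<bullet> e" for z
        have i1: "integrable \<gamma> (\<lambda>z. fst z \<bullet> e)" "(\<integral>z. fst z \<bullet> e \<partial>\<gamma>) = (\<integral>x. (x \<bullet> e) * u x \<partial>lborel) + s"
          using first_moment_shift[OF u, of "s *\<^sub>R e" e] e unfolding fst[symmetric]
          by (simp_all add: integrable_distr_eq integral_distr dot_square_norm)
        have i2: "integrable \<gamma> (\<lambda>z. snd z \<bullet> e)" "(\<integral>z. snd z \<bullet> e \<partial>\<gamma>) = (\<integral>x. (x \<bullet> e) * u x \<partial>lborel) + t"
          using first_moment_shift[OF u, of "t *\<^sub>R e" e] e unfolding snd[symmetric]
          by (simp_all add: integrable_distr_eq integral_distr dot_square_norm)
        have X: "integrable \<gamma> X" "(\<integral>z. X z \<partial>\<gamma>) = t - s"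
          using i1 i2 by (simp_all add: X_def[abs_def])
        \<comment> \<open>Jensen's inequality in tangent-line form: X^2 lies above its tangent at
          the mean \<open>t - s\<close>. Thus only integrability of \<open>X\<close> and of the
          squared distance enters.\<close>
        have "(t - s)\<^sup>2 = (\<integral>z. 2 * (t - s) * X z - (t - s)\<^sup>2 \<partial>\<gamma>)"
          using X by (simp add: mm power2_eq_square)
        also have "\<dots> \<le> (\<integral>z. ?d z \<partial>\<gamma>)"
        proof (rule integral_mono)
          show "2 * (t - s) * X z - (t - s)\<^sup>2 \<le> ?d z" for z
          proof -
            have "\<bar>X z\<bar> \<le> dist (fst z) (snd z)"
              using Cauchy_Schwarz_ineq2[of "snd z - fst z" e] e
              by (simp add: X_def inner_diff_left dist_norm norm_minus_commute)
            then have "(X z)\<^sup>2 \<le> ?d z" by (metis abs_ge_zero power2_abs power_mono)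
            moreover have "2 * (t - s) * X z - (t - s)\<^sup>2 \<le> (X z)\<^sup>2"
              using sum_squares_bound[of "t - s" "X z"] by simp
            ultimately show ?thesis by simp
          qed
        qed (use X int_d in auto)
        finally show ?thesis
          using int_d by (subst nn_integral_eq_integral) (auto simp: power2_commute)
      qed simp
    qed
  qed
  then show ?thesis by (simp add: W2_def)
qed

section \<open>The extended integral of an integrable function\<close>

lemma ext_integral_cong_AE:
  assumes "AE x in lborel. f x = g x"
  shows "ext_integral f = ext_integral g"
proof -
  have "(\<integral>\<^sup>+ x. ennreal (f x) \<partial>lborel) = (\<integral>\<^sup>+ x. ennreal (g x) \<partial>lborel)"
    "(\<integral>\<^sup>+ x. ennreal (- f x) \<partial>lborel) = (\<integral>\<^sup>+ x. ennreal (- g x) \<partial>lborel)"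
    using assms by (auto intro!: nn_integral_cong_AE)
  then show ?thesis by (simp add: ext_integral_def)
qed

lemma ext_integral_eq_integral:
  assumes "integrable lborel f"
  shows "ext_integral f = ereal (\<integral>x. f x \<partial>lborel)"
proof -
  have "(\<integral>\<^sup>+ x. ennreal (f x) \<partial>lborel) < \<infinity>" "(\<integral>\<^sup>+ x. ennreal (- f x) \<partial>lborel) < \<infinity>"
    using assms real_integrable_def[of lborel f] by (auto simp: less_top)
  then obtain a b where "0 \<le> a" "0 \<le> b" "(\<integral>\<^sup>+ x. ennreal (f x) \<partial>lborel) = ennreal a"
    "(\<integral>\<^sup>+ x. ennreal (- f x) \<partial>lborel) = ennreal b"
    by (metis ennreal_cases infinity_ennreal_def less_irrefl)
  then show ?thesis
    using real_lebesgue_integral_def[OF assms] by (simp add: ext_integral_def)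
qed

section \<open>Differentiating along a translation\<close>

text \<open>Locally in \<open>s\<close> all supports lie in one fixed box, where the Leibniz rule
  for compact domains applies. The bound on the support grows with \<open>\<bar>s\<bar>\<close>
  because the integrands are translates.\<close>

lemma DERIV_integral_bounded_support:
  fixes f f' :: "real \<Rightarrow> 'a::euclidean_space \<Rightarrow> real"
  assumes D: "\<And>s x. ((\<lambda>s. f s x) has_real_derivative f' s x) (at s)"
    and cf: "\<And>s. continuous_on UNIV (f s)"
    and cf': "continuous_on UNIV (\<lambda>(s, x). f' s x)"
    and f0: "\<And>s x. R + \<bar>s\<bar> < norm x \<Longrightarrow> f s x = 0"
    and f'0: "\<And>s x. R + \<bar>s\<bar> < norm x \<Longrightarrow> f' s x = 0"
  shows "((\<lambda>s. \<integral>x. f s x \<partial>lborel) has_real_derivative (\<integral>x. f' s x \<partial>lborel)) (at s)"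
proof -
  \<comment> \<open>For parameters in \<open>U\<close> the modulus stays below
    \<open>\<bar>s\<bar> + 1\<close>, which is the room left in the choice of the box.\<close>
  define U where "U = {s - 1<..<s + 1}"
  obtain B :: 'a where B: "cball 0 (R + \<bar>s\<bar> + 1) \<subseteq> cbox (- B) B"
    using bounded_subset_cbox_symmetric[of "cball 0 (R + \<bar>s\<bar> + 1)"] by auto
  have eq: "(\<integral>x. k x \<partial>lborel) = integral (cbox (- B) B) k"
    if k: "continuous_on UNIV k" "\<And>x. R + \<bar>\<sigma>\<bar> < norm x \<Longrightarrow> k x = 0" and "\<sigma> \<in> U" for k :: "'a \<Rightarrow> real" and \<sigma>
  proof -
    have "(k has_integral integral (cbox (- B) B) k) (cbox (- B) B)"
      by (intro integrable_integral integrable_continuous continuous_on_subset[OF k(1)]) auto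
    moreover have "k x = 0" if "x \<notin> cbox (- B) B" for x
    proof (rule k(2))
      have "R + \<bar>s\<bar> + 1 < norm x" using that B by (auto simp: subset_iff not_le[symmetric])
      then show "R + \<bar>\<sigma>\<bar> < norm x" using \<open>\<sigma> \<in> U\<close> by (auto simp: U_def)
    qed
    ultimately have "(k has_integral integral (cbox (- B) B) k) UNIV"
      by (rule has_integral_on_superset) auto
    moreover have "(k has_integral (\<integral>x. k x \<partial>lborel)) UNIV"
      by (intro has_integral_integral_lborel integrable_continuous_bounded_support k)
    ultimately show ?thesis using has_integral_unique by blast
  qed
  have s: "s \<in> U" and oU: "open U" by (simp_all add: U_def)
  have c': "continuous_on UNIV (f' s)"
  proof -
    have "continuous_on UNIV (\<lambda>x::'a. (s, x))" by (intro continuous_intros)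
    from continuous_on_compose2[OF cf' this] show ?thesis by simp
  qed
  have e1: "(\<integral>x. f' s x \<partial>lborel) = integral (cbox (- B) B) (f' s)" by (rule eq[OF c' f'0 s])
  have "((\<lambda>s. integral (cbox (- B) B) (f s)) has_real_derivative integral (cbox (- B) B) (f' s)) (at s within U)"
  proof (rule leibniz_rule_field_derivative)
    show "((\<lambda>s. f s x) has_real_derivative f' s x) (at s within U)" for s x
      using D by (rule has_field_derivative_at_within)
    show "f s integrable_on cbox (- B) B" for s
      by (intro integrable_continuous continuous_on_subset[OF cf]) auto
    show "continuous_on (U \<times> cbox (- B) B) (\<lambda>(s, x). f' s x)"
      by (rule continuous_on_subset[OF cf']) auto
    show "convex U" by (simp add: U_def)
  qed fact
  then have "((\<lambda>s. integral (cbox (- B) B) (f s)) has_real_derivative (\<integral>x. f' s x \<partial>lborel)) (at s)"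
    by (simp only: e1 at_within_open[OF s oU])
  then show ?thesis
  proof (rule has_field_derivative_transform_within_open[where S = U])
    show "integral (cbox (- B) B) (f \<sigma>) = (\<integral>x. f \<sigma> x \<partial>lborel)" if "\<sigma> \<in> U" for \<sigma>
      by (rule eq[OF cf f0 that, symmetric])
  qed (use s in \<open>auto simp: U_def\<close>)
qed

text \<open>Substituting \<open>x + s e\<close> for \<open>x\<close> between the two differentiations moves the second one
  onto the other factor, so that no second derivative of \<open>a\<close> appears.\<close>

lemma second_derivative_translation:
  fixes a a' :: "'a::euclidean_space \<Rightarrow> real" and g g1 g12 :: "real \<times> real \<Rightarrow> real"
  assumes a: "continuous_on UNIV a" "continuous_on UNIV a'"
      "\<And>x s. ((\<lambda>s. a (x + s *\<^sub>R e)) has_real_derivative a' (x + s *\<^sub>R e)) (at s)"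
      "\<And>x. R < norm x \<Longrightarrow> a x = 0" "\<And>x. R < norm x \<Longrightarrow> a' x = 0"
      "\<And>x. \<bar>a x\<bar> \<le> 1"
    and e: "norm e = 1"
    and cont: "continuous_on ({-1..1} \<times> {-1..1}) g" "continuous_on ({-1..1} \<times> {-1..1}) g1"
      "continuous_on ({-1..1} \<times> {-1..1}) g12"
    and D: "\<And>x y. \<bar>x\<bar> \<le> 1 \<Longrightarrow> \<bar>y\<bar> \<le> 1 \<Longrightarrow> ((\<lambda>x. g (x, y)) has_real_derivative g1 (x, y)) (at x)"
      "\<And>x y. \<bar>x\<bar> \<le> 1 \<Longrightarrow> \<bar>y\<bar> \<le> 1 \<Longrightarrow> ((\<lambda>y. g1 (x, y)) has_real_derivative g12 (x, y)) (at y)"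
  obtains K' where
    "\<And>s. ((\<lambda>s. \<integral>x. g (a (x - s *\<^sub>R e), a x) - g (0, a x) \<partial>lborel) has_real_derivative K' s) (at s)"
    "(K' has_real_derivative - (\<integral>x. g12 (a x, a x) * (a' x)\<^sup>2 \<partial>lborel)) (at 0)"
proof
  define K' where "K' s = (\<integral>x. - (g1 (a x, a (x + s *\<^sub>R e)) * a' x) \<partial>lborel)" for s
  have bd: "a x \<in> {-1..1}" for x using a(6)[of x] by (auto simp: abs_le_iff)
  have ca: "continuous_on S (\<lambda>p. a (t p))" "continuous_on S (\<lambda>p. a' (t p))" if "continuous_on S t"
    for t :: "'p::topological_space \<Rightarrow> 'a" and S
    by (intro continuous_on_compose2[OF a(1) that] continuous_on_compose2[OF a(2) that]; simp)+
  have cg: "continuous_on S (\<lambda>p. g (t p))" "continuous_on S (\<lambda>p. g1 (t p))" "continuous_on S (\<lambda>p. g12 (t p))"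
    if "continuous_on S t" "\<And>p. p \<in> S \<Longrightarrow> t p \<in> {-1..1} \<times> {-1..1}"
    for t :: "'p::topological_space \<Rightarrow> real \<times> real" and S
    using cont[THEN continuous_on_compose2, OF that(1)] that(2) by auto
  have far: "R < norm (x - s *\<^sub>R e)" "R < norm (x + s *\<^sub>R e)" "R < norm x" if "R + \<bar>s\<bar> < norm x" for s x
    using that e norm_triangle_ineq2[of x "s *\<^sub>R e"] norm_triangle_ineq2[of x "- (s *\<^sub>R e)"] by auto
  \<comment> \<open>The subtracted term \<open>g (0, a x)\<close> does not depend on
    \<open>s\<close>. It makes the integrand vanish where the translated \<open>a\<close> does,
    giving bounded support even when \<open>g (0, 0)\<close> is nonzero.\<close>
  show "((\<lambda>s. \<integral>x. g (a (x - s *\<^sub>R e), a x) - g (0, a x) \<partial>lborel) has_real_derivative K' s) (at s)" for s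
  proof -
    have "((\<lambda>s. \<integral>x. g (a (x - s *\<^sub>R e), a x) - g (0, a x) \<partial>lborel) has_real_derivative
        (\<integral>x. - (g1 (a (x - s *\<^sub>R e), a x) * a' (x - s *\<^sub>R e)) \<partial>lborel)) (at s)"
    proof (rule DERIV_integral_bounded_support[where R = R])
      fix s :: real and x :: 'a
      have "(uminus has_real_derivative -1) (at s)"
        by (auto intro!: derivative_eq_intros)
      from DERIV_chain2[where f = "\<lambda>s. a (x + s *\<^sub>R e)", OF a(3)[of x "- s"] this]
      have "((\<lambda>s. a (x - s *\<^sub>R e)) has_real_derivative - a' (x - s *\<^sub>R e)) (at s)" by simp
      from DERIV_chain2[where f = "\<lambda>y. g (y, a x)", OF D(1)[OF a(6) a(6)] this]
      show "((\<lambda>s. g (a (x - s *\<^sub>R e), a x) - g (0, a x)) has_real_derivative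
          - (g1 (a (x - s *\<^sub>R e), a x) * a' (x - s *\<^sub>R e))) (at s)"
        by (auto intro!: derivative_eq_intros)
    next
      show "continuous_on UNIV (\<lambda>x. g (a (x - s *\<^sub>R e), a x) - g (0, a x))" for s
        using bd by (intro continuous_intros ca cg) auto
      show "continuous_on UNIV (\<lambda>(s, x). - (g1 (a (x - s *\<^sub>R e), a x) * a' (x - s *\<^sub>R e)))"
        unfolding split_beta using bd by (intro continuous_intros ca cg) auto
    qed (use far a(4,5) in auto)
    moreover have "(\<integral>x. - (g1 (a (x - s *\<^sub>R e), a x) * a' (x - s *\<^sub>R e)) \<partial>lborel) = K' s"
    proof -
      have "continuous_on UNIV (\<lambda>x. - (g1 (a x, a (x + s *\<^sub>R e)) * a' x))"
        using bd by (intro continuous_intros ca cg) auto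
      then have "(\<lambda>x. - (g1 (a x, a (x + s *\<^sub>R e)) * a' x)) \<in> borel_measurable borel"
        by (rule borel_measurable_continuous_onI)
      from integral_lborel_shift(1)[OF this, of "- (s *\<^sub>R e)"] show ?thesis
        by (simp add: K'_def)
    qed
    ultimately show ?thesis by simp
  qed
  \<comment> \<open>One factor \<open>a'\<close> comes from each differentiation; at
    \<open>s = 0\<close> they sit at the same point and form a square.\<close>
  have "(K' has_real_derivative (\<integral>x. - (g12 (a x, a (x + 0 *\<^sub>R e)) * a' (x + 0 *\<^sub>R e) * a' x) \<partial>lborel)) (at 0)"
    unfolding K'_def
  proof (rule DERIV_integral_bounded_support[where R = R])
    fix s :: real and x :: 'a
    show "((\<lambda>s. - (g1 (a x, a (x + s *\<^sub>R e)) * a' x)) has_real_derivative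
        - (g12 (a x, a (x + s *\<^sub>R e)) * a' (x + s *\<^sub>R e) * a' x)) (at s)"
      by (rule derivative_eq_intros refl
            DERIV_chain2[where f = "\<lambda>y. g1 (a x, y)", OF D(2)[OF a(6) a(6)] a(3)])+ simp
  next
    show "continuous_on UNIV (\<lambda>x. - (g1 (a x, a (x + s *\<^sub>R e)) * a' x))" for s
      using bd by (intro continuous_intros ca cg) auto
    show "continuous_on UNIV (\<lambda>(s, x). - (g12 (a x, a (x + s *\<^sub>R e)) * a' (x + s *\<^sub>R e) * a' x))"
      unfolding split_beta using bd by (intro continuous_intros ca cg) auto
  qed (use far a(4,5) in auto)
  then show "(K' has_real_derivative - (\<integral>x. g12 (a x, a x) * (a' x)\<^sup>2 \<partial>lborel)) (at 0)"
    by (simp add: power2_eq_square mult.assoc)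
qed

text \<open>The derivatives of the sine and the cosine version have squares adding up to \<open>N\<^sup>2\<close> on the
  plateau, so one of the two works and no oscillatory integral has to be estimated.\<close>

lemma oscillating_bump:
  fixes e :: "'a::euclidean_space"
  assumes e: "norm e = 1" and r: "0 < r"
  obtains a where "smooth_on UNIV a" "\<And>x. \<bar>a x\<bar> \<le> 1" "\<And>x. 2 * r \<le> norm x \<Longrightarrow> a x = 0"
    "\<omega> \<le> (\<integral>x. (frechet_derivative a (at x) e)\<^sup>2 \<partial>lborel)"
proof -
  define b :: "'a \<Rightarrow> real" where "b = cutoff r (2 * r)"
  define V where "V = measure lborel (ball (0::'a) r)"
  have V: "0 < V" unfolding V_def by (rule content_ball_pos[OF r])
  \<comment> \<open>The factor 2 pays for keeping only one of the two candidates. The summand 1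
    ensures, for positive \<open>\<omega>\<close>, that \<open>N\<close> exceeds 1 and hence is at
    most its square.\<close>
  obtain N :: nat where N: "2 * \<omega> / V + 1 < real N" using reals_Archimedean2 by blast
  have NV: "2 * \<omega> \<le> (real N)\<^sup>2 * V"
  proof (cases "\<omega> \<le> 0")
    case True
    then show ?thesis using V by (smt (verit) mult_nonneg_nonneg zero_le_power2)
  next
    case False
    then have "1 < real N" "2 * \<omega> / V < real N" using N V by (smt (verit) divide_nonneg_pos)+
    then have "2 * \<omega> < real N * V" "real N \<le> (real N)\<^sup>2" using V by (auto simp: field_simps power2_eq_square)
    then show ?thesis using V by (smt (verit) mult_right_mono)
  qed
  define a1 where "a1 x = b x * sin ((x \<bullet> e) * N)" for x
  define a2 where "a2 x = b x * cos ((x \<bullet> e) * N)" for x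
  have sb: "smooth_on UNIV b" unfolding b_def by (rule smooth_cutoff)
  have "smooth_on UNIV (sin :: real \<Rightarrow> real)" "smooth_on UNIV (cos :: real \<Rightarrow> real)"
    using Ck_sin_cos by (simp_all add: smooth_on_def)
  note sc = this
  have "smooth_on UNIV (\<lambda>x. (x \<bullet> e) * N)"
    by (intro smooth_on_mult smooth_on_inner smooth_on_const)
  note sc = sc[THEN smooth_on_compose, OF this]
  have sm: "smooth_on UNIV a1" "smooth_on UNIV a2"
    unfolding a1_def a2_def by (rule smooth_on_mult[OF sb sc(1)], rule smooth_on_mult[OF sb sc(2)])
  have b01: "0 \<le> b x" "b x \<le> 1" for x unfolding b_def by (rule cutoff_bounds)+
  have bd: "\<bar>a1 x\<bar> \<le> 1" "\<bar>a2 x\<bar> \<le> 1" for x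
    using b01[of x] by (auto simp: a1_def a2_def abs_mult intro!: mult_le_one)
  have sup: "a1 x = 0" "a2 x = 0" if "2 * r \<le> norm x" for x
    using cutoff_eq_0[of r "2 * r" x] r that by (simp_all add: a1_def a2_def b_def)
  let ?D = "\<lambda>a x. frechet_derivative a (at x) e"
  have int: "integrable lborel (\<lambda>x. (?D a x)\<^sup>2)"
    if "smooth_on UNIV a" "\<And>x. 2 * r \<le> norm x \<Longrightarrow> a x = 0" for a :: "'a \<Rightarrow> real"
    using frechet_derivative_outside_support[of "2 * r" a] that smooth_on_imp_continuous[OF smooth_onD(2)[OF that(1)], of e]
    by (intro integrable_continuous_bounded_support[where R = "2 * r"] continuous_intros) auto
  have sq: "(?D a1 x)\<^sup>2 + (?D a2 x)\<^sup>2 = (real N)\<^sup>2" if "norm x < r" for x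
  proof -
    have "((\<lambda>x. 1) has_derivative (\<lambda>_. 0)) (at x)" by simp
    then have B: "(b has_derivative (\<lambda>_. 0)) (at x)"
      by (rule has_derivative_transform_within_open[where s = "ball 0 r"])
         (use that r cutoff_eq_1[of r "2 * r", OF _ _ less_imp_le] in \<open>auto simp: b_def\<close>)
    have bx: "b x = 1" using that r cutoff_eq_1[of r "2 * r" x] by (auto simp: b_def)
    have "(a1 has_derivative (\<lambda>v. cos ((x \<bullet> e) * N) * ((v \<bullet> e) * N))) (at x)"
      unfolding a1_def by (rule B derivative_eq_intros refl)+ (simp add: bx mult.commute)
    moreover have "(a2 has_derivative (\<lambda>v. - sin ((x \<bullet> e) * N) * ((v \<bullet> e) * N))) (at x)"
      unfolding a2_def by (rule B derivative_eq_intros refl)+ (simp add: bx mult.commute)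
    ultimately have "?D a1 x = cos ((x \<bullet> e) * N) * N" "?D a2 x = - sin ((x \<bullet> e) * N) * N"
      using e by (simp_all add: frechet_derivative_at[symmetric] dot_square_norm)
    then show ?thesis
      by (simp add: power_mult_distrib distrib_right[symmetric])
  qed
  \<comment> \<open>Outside the inner ball the sum of squares is only bounded below by 0.\<close>
  have "(real N)\<^sup>2 * V = (\<integral>x. (real N)\<^sup>2 * indicator (ball (0::'a) r) x \<partial>lborel)"
    by (simp add: V_def)
  also have "\<dots> \<le> (\<integral>x. (?D a1 x)\<^sup>2 + (?D a2 x)\<^sup>2 \<partial>lborel)"
  proof (rule integral_mono)
    show "integrable lborel (\<lambda>x::'a. (real N)\<^sup>2 * indicator (ball 0 r) x)"
      by (intro integrable_mult_right integrable_real_indicator) (use emeasure_lborel_ball_finite in auto)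
    show "(real N)\<^sup>2 * indicator (ball 0 r) x \<le> (?D a1 x)\<^sup>2 + (?D a2 x)\<^sup>2" for x
      using sq[of x] by (cases "norm x < r") (auto simp: indicator_def)
  qed (intro Bochner_Integration.integrable_add int sm sup)
  also have "\<dots> = (\<integral>x. (?D a1 x)\<^sup>2 \<partial>lborel) + (\<integral>x. (?D a2 x)\<^sup>2 \<partial>lborel)"
    by (intro Bochner_Integration.integral_add int sm sup)
  finally have "\<omega> \<le> (\<integral>x. (?D a1 x)\<^sup>2 \<partial>lborel) \<or> \<omega> \<le> (\<integral>x. (?D a2 x)\<^sup>2 \<partial>lborel)"
    using NV by linarith
  then show thesis using that sm bd sup by blast
qed

section \<open>The mixed derivative of the coupling\<close>

lemma interior_quadrant: "interior quadrant = {0<..} \<times> {0<..}"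
  by (simp add: interior_Times interior_real_atLeast)

lemma coupling_term_continuous: "coupling_term \<epsilon>s F G h \<Longrightarrow> continuous_on quadrant h"
  by (simp add: coupling_term_def C1_on_def differentiable_imp_continuous_on)

lemma coupling_term_boundary:
  assumes "coupling_term \<epsilon>s F G h" and "0 \<le> y"
  shows "h (0, y) = 0" "h (y, 0) = 0"
proof -
  have "(0, y) \<in> frontier quadrant" "(y, 0) \<in> frontier quadrant"
    using assms(2) by (auto simp: frontier_def interior_quadrant closed_Times)
  then show "h (0, y) = 0" "h (y, 0) = 0" using assms(1) unfolding coupling_term_def by blast+
qed

text \<open>If the mixed derivative vanished, \<open>h1\<close> would not depend on
  \<open>y\<close>, so \<open>h (x, y) - h (x, y')\<close> would not depend on \<open>x\<close>.
  Letting \<open>x\<close> tend to 0 shows that this difference is zero; then \<open>h\<close> is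
  constant in \<open>y\<close>, and letting \<open>y\<close> tend to 0 gives \<open>h = 0\<close>
  everywhere.\<close>

lemma coupling_mixed_derivative_nonzero:
  assumes cp: "coupling_term \<epsilon>s F G h" and nz: "\<exists>p\<in>quadrant. h p \<noteq> 0"
    and D1: "\<And>x y. 0 < x \<Longrightarrow> 0 < y \<Longrightarrow> ((\<lambda>x. h (x, y)) has_real_derivative h1 (x, y)) (at x)"
    and D12: "\<And>x y. 0 < x \<Longrightarrow> 0 < y \<Longrightarrow> ((\<lambda>y. h1 (x, y)) has_real_derivative h12 (x, y)) (at y)"
  shows "\<exists>x>0. \<exists>y>0. h12 (x, y) \<noteq> 0"
proof (rule ccontr)
  assume "\<not> ?thesis"
  then have z: "h12 (x, y) = 0" if "0 < x" "0 < y" for x y using that by blast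
  have c1: "continuous_on {0..} (\<lambda>t. h (t, y))" "continuous_on {0..} (\<lambda>t. h (y, t))" if "0 \<le> y" for y
    using that by (auto intro!: continuous_on_compose2[OF coupling_term_continuous[OF cp]] continuous_intros)
  have cl: "closure {0<..} = {0::real..}" by (rule closure_greaterThan)
  have cl0: "0 \<in> closure {0::real<..}" unfolding cl by simp
  have h1: "h1 (x, y) = h1 (x, y')" if "0 < x" "0 < y" "0 < y'" for x y y'
  proof -
    have "\<exists>c. \<forall>t\<in>{0<..}. h1 (x, t) = c"
    proof (rule has_field_derivative_zero_constant)
      fix t :: real assume "t \<in> {0<..}"
      then have t: "0 < t" by simp
      show "((\<lambda>t. h1 (x, t)) has_real_derivative 0) (at t within {0<..})"
        using has_field_derivative_at_within[OF D12[OF that(1) t], of "{0<..}"] z[OF that(1) t] by simp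
    qed simp
    then show ?thesis using that by auto
  qed
  have hy: "h (x, y) = h (x, y')" if "0 < x" "0 < y" "0 < y'" for x y y'
  proof -
    have "\<exists>c. \<forall>t\<in>{0<..}. h (t, y) - h (t, y') = c"
    proof (rule has_field_derivative_zero_constant)
      fix t :: real assume t: "t \<in> {0<..}"
      have "((\<lambda>t. h (t, y) - h (t, y')) has_real_derivative h1 (t, y) - h1 (t, y')) (at t)"
        using t that by (intro DERIV_diff D1) auto
      then show "((\<lambda>t. h (t, y) - h (t, y')) has_real_derivative 0) (at t within {0<..})"
        using h1[of t y y'] t that by (auto intro: has_field_derivative_at_within)
    qed simp
    then obtain c where c: "\<And>t. t \<in> {0<..} \<Longrightarrow> h (t, y) - h (t, y') = c" by blast
    \<comment> \<open>Continuity up to the boundary extends the constancy to \<open>t = 0\<close>,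
      where both terms vanish.\<close>
    have "continuous_on (closure {0<..}) (\<lambda>t. h (t, y) - h (t, y'))"
      unfolding cl using that by (intro continuous_intros c1) auto
    from continuous_constant_on_closure[OF this c] have "h (0, y) - h (0, y') = c"
      by (simp add: cl)
    then show ?thesis using c[of x] that coupling_term_boundary[OF cp] by simp
  qed
  have "h (x, y) = 0" if "0 < x" "0 < y" for x y
  proof -
    have "continuous_on (closure {0<..}) (\<lambda>t. h (x, t))"
      unfolding cl using that by (intro c1) auto
    moreover have "h (x, t) = h (x, y)" if "t \<in> {0<..}" for t
      using that by (intro hy \<open>0 < x\<close> \<open>0 < y\<close>) simp
    ultimately have "h (x, 0) = h (x, y)"
      using continuous_constant_on_closure[OF _ _ cl0] by blast
    then show ?thesis using that coupling_term_boundary[OF cp] by simp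
  qed
  then show False
    using nz coupling_term_boundary[OF cp] by (metis SigmaE atLeast_iff order_le_less)
qed

text \<open>A nonzero value of the continuous mixed derivative persists, with its sign
  \<open>\<sigma>\<close> and at least half its modulus \<open>\<kappa>\<close>, on a closed square
  inside the open quadrant.\<close>

lemma coupling_mixed_derivative:
  assumes cp: "coupling_term \<epsilon>s F G h" and nz: "\<exists>p\<in>quadrant. h p \<noteq> 0"
  obtains \<rho> ub vb \<kappa> \<sigma> :: real and h1 h12 :: "real \<times> real \<Rightarrow> real"
  where "0 < \<rho>" "\<rho> < ub" "\<rho> < vb" "0 < \<kappa>" "\<bar>\<sigma>\<bar> = 1"
    "continuous_on ({ub - \<rho>..ub + \<rho>} \<times> {vb - \<rho>..vb + \<rho>}) h1"
    "continuous_on ({ub - \<rho>..ub + \<rho>} \<times> {vb - \<rho>..vb + \<rho>}) h12"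
    "\<And>x y. \<bar>x - ub\<bar> \<le> \<rho> \<Longrightarrow> \<bar>y - vb\<bar> \<le> \<rho> \<Longrightarrow> ((\<lambda>x. h (x, y)) has_real_derivative h1 (x, y)) (at x)"
    "\<And>x y. \<bar>x - ub\<bar> \<le> \<rho> \<Longrightarrow> \<bar>y - vb\<bar> \<le> \<rho> \<Longrightarrow> ((\<lambda>y. h1 (x, y)) has_real_derivative h12 (x, y)) (at y)"
    "\<And>x y. \<bar>x - ub\<bar> \<le> \<rho> \<Longrightarrow> \<bar>y - vb\<bar> \<le> \<rho> \<Longrightarrow> \<kappa> \<le> \<sigma> * h12 (x, y)"
proof -
  define Q :: "(real \<times> real) set" where "Q = {0<..} \<times> {0<..}"
  define h1 where "h1 p = frechet_derivative h (at p) (1, 0)" for p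
  define h12 where "h12 p = frechet_derivative h1 (at p) (0, 1)" for p
  have "Ck_on (Suc (Suc 0)) Q h" using cp by (auto simp: coupling_term_def smooth_on_def Q_def)
  then have dh: "\<And>p. p \<in> Q \<Longrightarrow> h differentiable (at p)" and "Ck_on (Suc 0) Q h1"
    by (auto simp: h1_def[abs_def])
  then have dh1: "\<And>p. p \<in> Q \<Longrightarrow> h1 differentiable (at p)" and c12: "continuous_on Q h12"
    by (auto simp: h12_def[abs_def])
  have c1: "continuous_on Q h1"
    using dh1 by (intro continuous_at_imp_continuous_on) (auto intro: differentiable_imp_continuous_within)
  have D1: "((\<lambda>x. h (x, y)) has_real_derivative h1 (x, y)) (at x)" if "0 < x" "0 < y" for x y
  proof -
    have d: "(h has_derivative frechet_derivative h (at (x, y))) (at (x, y))"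
      using dh that by (auto simp: Q_def frechet_derivative_works)
    have "((\<lambda>x. (x, y)) has_derivative (\<lambda>t. (t, 0))) (at x)" by (auto intro!: derivative_eq_intros)
    from has_derivative_compose[OF this d]
    have "((\<lambda>x. h (x, y)) has_derivative (\<lambda>t. frechet_derivative h (at (x, y)) (t, 0))) (at x)" .
    moreover have "frechet_derivative h (at (x, y)) (t, 0) = h1 (x, y) * t" for t
      using linear_cmul[OF has_derivative_linear[OF d], of t "(1, 0)"] by (simp add: h1_def)
    ultimately show ?thesis by (simp add: has_field_derivative_def)
  qed
  have D12: "((\<lambda>y. h1 (x, y)) has_real_derivative h12 (x, y)) (at y)" if "0 < x" "0 < y" for x y
  proof -
    have d: "(h1 has_derivative frechet_derivative h1 (at (x, y))) (at (x, y))"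
      using dh1 that by (auto simp: Q_def frechet_derivative_works)
    have "((\<lambda>y. (x, y)) has_derivative (\<lambda>t. (0, t))) (at y)" by (auto intro!: derivative_eq_intros)
    from has_derivative_compose[OF this d]
    have "((\<lambda>y. h1 (x, y)) has_derivative (\<lambda>t. frechet_derivative h1 (at (x, y)) (0, t))) (at y)" .
    moreover have "frechet_derivative h1 (at (x, y)) (0, t) = h12 (x, y) * t" for t
      using linear_cmul[OF has_derivative_linear[OF d], of t "(0, 1)"] by (simp add: h12_def)
    ultimately show ?thesis by (simp add: has_field_derivative_def)
  qed
  obtain ub vb where b: "0 < ub" "0 < vb" and b0: "h12 (ub, vb) \<noteq> 0"
    using coupling_mixed_derivative_nonzero[OF cp nz D1 D12] by blast
  define \<kappa> where "\<kappa> = \<bar>h12 (ub, vb)\<bar> / 2"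
  define \<sigma> where "\<sigma> = sgn (h12 (ub, vb))"
  have \<kappa>: "0 < \<kappa>" using b0 by (simp add: \<kappa>_def)
  have "open Q" by (simp add: Q_def open_Times)
  then have "isCont h12 (ub, vb)"
    using c12 b by (simp add: continuous_on_eq_continuous_at Q_def)
  then obtain d where d: "0 < d" "\<And>p. dist p (ub, vb) < d \<Longrightarrow> dist (h12 p) (h12 (ub, vb)) < \<kappa>"
    using \<kappa> unfolding continuous_at_eps_delta by (metis dist_commute)
  \<comment> \<open>Points of the square have distance at most \<open>2 * \<rho>\<close> from its
    centre, and \<open>d / 3\<close> keeps this below \<open>d\<close>; the other bound keeps the
    square off the axes.\<close>
  define \<rho> where "\<rho> = min (d / 3) (min ub vb / 2)"
  have \<rho>: "0 < \<rho>" "\<rho> < ub" "\<rho> < vb" "2 * \<rho> < d" using b d(1) by (auto simp: \<rho>_def min_def)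
  have pos: "0 < x" "0 < y" if "\<bar>x - ub\<bar> \<le> \<rho>" "\<bar>y - vb\<bar> \<le> \<rho>" for x y using that \<rho> by linarith+
  have sub: "{ub - \<rho>..ub + \<rho>} \<times> {vb - \<rho>..vb + \<rho>} \<subseteq> Q" using \<rho> by (auto simp: Q_def)
  have est: "\<kappa> \<le> \<sigma> * h12 (x, y)" if "\<bar>x - ub\<bar> \<le> \<rho>" "\<bar>y - vb\<bar> \<le> \<rho>" for x y
  proof -
    have "dist (x, y) (ub, vb) \<le> \<bar>x - ub\<bar> + \<bar>y - vb\<bar>"
      using sqrt_sum_squares_le_sum_abs by (simp add: dist_Pair_Pair dist_real_def)
    then have "\<bar>h12 (x, y) - h12 (ub, vb)\<bar> < \<kappa>"
      using d(2)[of "(x, y)"] that \<rho>(4) by (simp add: dist_real_def)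
    then show ?thesis
      unfolding \<kappa>_def \<sigma>_def by (auto simp: sgn_if abs_if split: if_splits)
  qed
  show thesis
    by (rule that[of \<rho> ub vb \<kappa> \<sigma> h1 h12, OF \<rho>(1-3) \<kappa> _ continuous_on_subset[OF c1 sub]
          continuous_on_subset[OF c12 sub] D1[OF pos] D12[OF pos] est])
       (use b0 in \<open>auto simp: \<sigma>_def sgn_if\<close>)
qed

section \<open>Oscillating densities\<close>

text \<open>The missing mass is added as a nonnegative multiple of a smooth bump in the unit ball
  around \<open>c\<close>. Leaving \<open>c\<close> free allows the bumps of \<open>u\<close> and
  \<open>v\<close> to be kept apart.\<close>

lemma complete_to_density:
  fixes w :: "'a::euclidean_space \<Rightarrow> real"
  assumes w: "smooth_on UNIV w" "\<And>x. 0 \<le> w x" "\<And>x. R < norm x \<Longrightarrow> w x = 0" "(\<integral>x. w x \<partial>lborel) \<le> 1"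
  obtains U R' where "smooth_on UNIV U" "U \<in> density_P2" "\<And>x. 1 \<le> norm (x - c) \<Longrightarrow> U x = w x"
    "\<And>x. R' < norm x \<Longrightarrow> U x = 0"
proof -
  let ?b = "\<lambda>x::'a. cutoff (1 / 2) 1 x"
  have sb: "smooth_on UNIV ?b" by (rule smooth_cutoff)
  have b0: "?b x = 0" if "1 \<le> norm x" for x by (rule cutoff_eq_0) (use that in auto)
  have ib: "integrable lborel ?b"
    by (rule integrable_continuous_bounded_support[OF smooth_on_imp_continuous[OF sb], of 1]) (auto intro: b0)
  define B where "B = (\<integral>x. ?b x \<partial>lborel)"
  \<comment> \<open>The bump has positive mass because it dominates the indicator of the ball of
    radius 1/2.\<close>
  have "0 < measure lborel (ball (0::'a) (1 / 2))" by (rule content_ball_pos) simp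
  also have "\<dots> = (\<integral>x. indicator (ball (0::'a) (1 / 2)) x \<partial>lborel)" by simp
  also have "\<dots> \<le> B" unfolding B_def
  proof (rule integral_mono)
    show "integrable lborel (indicator (ball (0::'a) (1 / 2)) :: 'a \<Rightarrow> real)"
      by (intro integrable_real_indicator) (use emeasure_lborel_ball_finite in auto)
    show "indicator (ball 0 (1 / 2)) x \<le> ?b x" for x
      using cutoff_eq_1[of "1 / 2" 1 x] cutoff_bounds(1)[of "1 / 2" 1 x] by (auto simp: indicator_def)
  qed (rule ib)
  finally have B: "0 < B" .
  define \<mu> where "\<mu> = (1 - (\<integral>x. w x \<partial>lborel)) / B"
  have \<mu>: "0 \<le> \<mu>" using B w(4) by (simp add: \<mu>_def)
  define U where "U x = w x + \<mu> * ?b (x - c)" for x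
  define R' where "R' = max R (norm c + 1)"
  have sU: "smooth_on UNIV U"
    unfolding U_def by (intro smooth_on_add smooth_on_mult smooth_on_const smooth_on_shift w(1) smooth_cutoff)
  have far: "U x = 0" if "R' < norm x" for x
  proof -
    have "1 \<le> norm (x - c)" using that norm_triangle_ineq2[of x c] by (auto simp: R'_def)
    then show ?thesis using b0 w(3)[of x] that by (simp add: U_def R'_def)
  qed
  note cU = smooth_on_imp_continuous[OF sU]
  have iw: "integrable lborel w"
    by (rule integrable_continuous_bounded_support[OF smooth_on_imp_continuous[OF w(1)] w(3)])
  have mb: "?b \<in> borel_measurable borel"
    by (intro borel_measurable_continuous_onI smooth_on_imp_continuous sb)
  have "(\<integral>x. U x \<partial>lborel) = (\<integral>x. w x \<partial>lborel) + \<mu> * B"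
    using iw ib integral_lborel_shift[OF mb, of "- c"] by (simp add: U_def B_def)
  then have "(\<integral>x. U x \<partial>lborel) = 1" using B by (simp add: \<mu>_def)
  moreover have "integrable lborel U" "integrable lborel (\<lambda>x. (norm x)\<^sup>2 * U x)"
    using far by (auto intro!: integrable_continuous_bounded_support[where R = R'] cU continuous_intros)
  moreover have "0 \<le> U x" for x
    unfolding U_def by (intro add_nonneg_nonneg mult_nonneg_nonneg w(2) \<mu> cutoff_bounds)
  ultimately have "U \<in> density_P2"
    using cU by (simp add: density_P2_def borel_measurable_continuous_onI)
  moreover have "U x = w x" if "1 \<le> norm (x - c)" for x using b0 that by (simp add: U_def)
  ultimately show thesis using that sU far by blast
qed

text \<open>The volume scales like r^d, which is at most r when r is at most 1. This allows
  prescribed heights on a ball of radius \<open>6 * r\<close> without exceeding unit mass.\<close>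

lemma small_ball:
  fixes M :: real
  obtains r where "0 < r" "r \<le> 1" "M * measure lborel (cball (0::'a::euclidean_space) (6 * r)) \<le> 1"
proof -
  define V where "V = \<bar>M\<bar> * unit_ball_vol (real DIM('a)) * 6 ^ DIM('a)"
  have V: "0 \<le> V" by (simp add: V_def)
  define r where "r = 1 / (V + 1)"
  have r: "0 < r" "r \<le> 1" using V by (simp_all add: r_def)
  have "M * measure lborel (cball (0::'a) (6 * r)) \<le> \<bar>M\<bar> * measure lborel (cball (0::'a) (6 * r))"
    by (intro mult_right_mono) auto
  also have "\<dots> = V * r ^ DIM('a)"
    using r by (simp add: V_def content_cball power_mult_distrib)
  also have "\<dots> \<le> V * r"
    using r V power_decreasing[of 1 "DIM('a)" r] by (intro mult_left_mono) auto
  also have "\<dots> \<le> 1" using V by (simp add: r_def)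
  finally show thesis using that r by blast
qed

text \<open>As \<open>h\<close> vanishes on the axes, the integrand is zero wherever
  \<open>v\<close> is, so its support stays bounded however \<open>u\<close> is shifted.\<close>

lemma integrable_coupling:
  fixes u v :: "'a::euclidean_space \<Rightarrow> real"
  assumes cp: "coupling_term \<epsilon>s F G h"
    and "continuous_on UNIV u" "continuous_on UNIV v" "\<And>x. 0 \<le> u x" "\<And>x. 0 \<le> v x"
    and "\<And>x. R < norm x \<Longrightarrow> v x = 0"
  shows "integrable lborel (\<lambda>x. h (u x, v x))"
proof (rule integrable_continuous_bounded_support)
  show "continuous_on UNIV (\<lambda>x. h (u x, v x))"
    using assms by (intro continuous_on_compose2[OF coupling_term_continuous[OF cp]] continuous_intros) auto
  show "h (u x, v x) = 0" if "R < norm x" for x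
    using assms that coupling_term_boundary[OF cp] by simp
qed

lemma oscillating_densities:
  fixes e :: "'a::euclidean_space"
  assumes cp: "coupling_term \<epsilon>s F G h" and nz: "\<exists>p\<in>quadrant. h p \<noteq> 0" and e: "norm e = 1"
  obtains u v :: "'a \<Rightarrow> real" and R r f' c where
    "u \<in> density_P2" "v \<in> density_P2" "smooth_on UNIV u" "smooth_on UNIV v"
    "\<And>x. R < norm x \<Longrightarrow> u x = 0" "\<And>x. R < norm x \<Longrightarrow> v x = 0" "0 < r"
    "\<And>s. \<bar>s\<bar> < r \<Longrightarrow> ((\<lambda>s. \<integral>x. h (u (x - s *\<^sub>R e), v x) \<partial>lborel) has_real_derivative f' s) (at s)"
    "(f' has_real_derivative c) (at 0)" "c \<le> - \<omega>"
proof -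
  obtain ub vb \<rho> \<kappa> \<sigma> h1 h12 where
    \<rho>: "0 < \<rho>" "\<rho> < ub" "\<rho> < vb" "0 < \<kappa>" "\<bar>\<sigma>\<bar> = 1" and
    ch1: "continuous_on ({ub - \<rho>..ub + \<rho>} \<times> {vb - \<rho>..vb + \<rho>}) h1" and
    ch12: "continuous_on ({ub - \<rho>..ub + \<rho>} \<times> {vb - \<rho>..vb + \<rho>}) h12" and
    D1: "\<And>x y. \<bar>x - ub\<bar> \<le> \<rho> \<Longrightarrow> \<bar>y - vb\<bar> \<le> \<rho> \<Longrightarrow> ((\<lambda>x. h (x, y)) has_real_derivative h1 (x, y)) (at x)" and
    D2: "\<And>x y. \<bar>x - ub\<bar> \<le> \<rho> \<Longrightarrow> \<bar>y - vb\<bar> \<le> \<rho> \<Longrightarrow> ((\<lambda>y. h1 (x, y)) has_real_derivative h12 (x, y)) (at y)" and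
    h12: "\<And>x y. \<bar>x - ub\<bar> \<le> \<rho> \<Longrightarrow> \<bar>y - vb\<bar> \<le> \<rho> \<Longrightarrow> \<kappa> \<le> \<sigma> * h12 (x, y)"
  proof -
    show thesis
      by (rule coupling_mixed_derivative[OF cp nz]) (fact that)
  qed
  \<comment> \<open>The outer radius of the patterns below is \<open>6 * r\<close>, and
    \<open>2 * (ub + vb)\<close> bounds their heights.\<close>
  obtain r where r: "0 < r" "r \<le> 1" "(2 * (ub + vb)) * measure lborel (cball (0::'a) (6 * r)) \<le> 1"
    using small_ball[where 'a = 'a and M = "2 * (ub + vb)"] by blast
  \<comment> \<open>Dividing by \<open>\<rho>\<^sup>2 * \<kappa>\<close> anticipates the lower bound
    on \<open>g12\<close>.\<close>
  obtain a where sa: "smooth_on UNIV a" and a1: "\<And>x. \<bar>a x\<bar> \<le> 1"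
    and a0: "\<And>x. 2 * r \<le> norm x \<Longrightarrow> a x = 0"
    and large: "\<omega> / (\<rho>\<^sup>2 * \<kappa>) \<le> (\<integral>x. (frechet_derivative a (at x) e)\<^sup>2 \<partial>lborel)"
  proof -
    show thesis
      by (rule oscillating_bump[OF e r(1)]) (fact that)
  qed
  define a' where "a' x = frechet_derivative a (at x) e" for x
  have ca: "continuous_on UNIV a" "continuous_on UNIV a'"
    unfolding a'_def by (intro smooth_on_imp_continuous sa smooth_onD(2))+
  have Da: "((\<lambda>s. a (x + s *\<^sub>R e)) has_real_derivative a' (x + s *\<^sub>R e)) (at s)" for x s
    unfolding a'_def by (rule smooth_on_DERIV_line[OF sa])
  have a0': "a x = 0" if "2 * r < norm x" for x using that by (intro a0) simp
  have a'0: "a' x = 0" if "2 * r < norm x" for x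
    unfolding a'_def by (rule frechet_derivative_outside_support[OF a0 that])
  \<comment> \<open>The coupling in coordinates where both densities oscillate by the same
    \<open>a\<close>. The sign \<open>\<sigma>\<close> in the second coordinate makes
    \<open>g12\<close> at least \<open>\<rho>\<^sup>2 * \<kappa>\<close> on the unit square.\<close>
  define g where "g p = h (ub + \<rho> * fst p, vb + \<sigma> * \<rho> * snd p)" for p
  define g1 where "g1 p = \<rho> * h1 (ub + \<rho> * fst p, vb + \<sigma> * \<rho> * snd p)" for p
  define g12 where "g12 p = \<rho> * (\<sigma> * \<rho>) * h12 (ub + \<rho> * fst p, vb + \<sigma> * \<rho> * snd p)" for p
  have b\<rho>: "\<bar>\<rho> * x\<bar> \<le> \<rho>" "\<bar>\<sigma> * \<rho> * x\<bar> \<le> \<rho>" if "\<bar>x\<bar> \<le> 1" for x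
    using that \<rho>(1,5) mult_left_mono[of "\<bar>x\<bar>" 1 \<rho>] by (auto simp: abs_mult)
  have box: "(ub + \<rho> * fst p, vb + \<sigma> * \<rho> * snd p) \<in> {ub - \<rho>..ub + \<rho>} \<times> {vb - \<rho>..vb + \<rho>}"
    if "p \<in> {-1..1} \<times> {-1..1}" for p
  proof -
    have "\<bar>fst p\<bar> \<le> 1" "\<bar>snd p\<bar> \<le> 1" using that by (auto simp: abs_le_iff)
    from b\<rho>(1)[OF this(1)] b\<rho>(2)[OF this(2)] show ?thesis by (auto simp: abs_le_iff)
  qed
  have G0: "continuous_on ({-1..1} \<times> {-1..1}) g" unfolding g_def
  proof (rule continuous_on_compose2[OF coupling_term_continuous[OF cp]])
    show "(\<lambda>p. (ub + \<rho> * fst p, vb + \<sigma> * \<rho> * snd p)) ` ({-1..1} \<times> {-1..1}) \<subseteq> quadrant"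
      using box \<rho> by fastforce
  qed (intro continuous_intros)
  have G1: "continuous_on ({-1..1} \<times> {-1..1}) g1" unfolding g1_def
    by (intro continuous_on_mult continuous_on_const continuous_on_compose2[OF ch1] continuous_intros)
       (use box in blast)
  have G12: "continuous_on ({-1..1} \<times> {-1..1}) g12" unfolding g12_def
    by (intro continuous_on_mult[where f = "\<lambda>_. \<rho> * (\<sigma> * \<rho>)"] continuous_on_const continuous_on_compose2[OF ch12] continuous_intros)
       (use box in blast)
  have DG1: "((\<lambda>x. g (x, y)) has_real_derivative g1 (x, y)) (at x)"
    if "\<bar>x\<bar> \<le> 1" "\<bar>y\<bar> \<le> 1" for x y
  proof -
    have "((\<lambda>x. ub + \<rho> * x) has_real_derivative \<rho>) (at x)" by (auto intro!: derivative_eq_intros)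
    from DERIV_chain2[where f = "\<lambda>z. h (z, vb + \<sigma> * \<rho> * y)", OF D1 this] show ?thesis
      using b\<rho>(1)[OF that(1)] b\<rho>(2)[OF that(2)] by (simp add: g_def g1_def mult.commute)
  qed
  have DG2: "((\<lambda>y. g1 (x, y)) has_real_derivative g12 (x, y)) (at y)"
    if "\<bar>x\<bar> \<le> 1" "\<bar>y\<bar> \<le> 1" for x y
  proof -
    have "((\<lambda>y. vb + \<sigma> * \<rho> * y) has_real_derivative \<sigma> * \<rho>) (at y)" by (auto intro!: derivative_eq_intros)
    from DERIV_chain2[where f = "\<lambda>z. h1 (ub + \<rho> * x, z)", OF D2 this]
    have "((\<lambda>y. h1 (ub + \<rho> * x, vb + \<sigma> * \<rho> * y)) has_real_derivative
        h12 (ub + \<rho> * x, vb + \<sigma> * \<rho> * y) * (\<sigma> * \<rho>)) (at y)"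
      using b\<rho>(1)[OF that(1)] b\<rho>(2)[OF that(2)] by simp
    from DERIV_cmult[OF this, of \<rho>] show ?thesis by (simp add: g1_def g12_def mult_ac)
  qed
  obtain f' where
    f': "\<And>s. ((\<lambda>s. \<integral>x. g (a (x - s *\<^sub>R e), a x) - g (0, a x) \<partial>lborel) has_real_derivative f' s) (at s)" and
    f'': "(f' has_real_derivative - (\<integral>x. g12 (a x, a x) * (a' x)\<^sup>2 \<partial>lborel)) (at 0)"
  proof -
    show thesis
      by (rule second_derivative_translation[of a a' e "2 * r" g g1 g12])
        (fact ca Da a0' a'0 a1 e G0 G1 G12 DG1 DG2 that)+
  qed
  have int_a': "integrable lborel (\<lambda>x. (a' x)\<^sup>2)"
    by (rule integrable_continuous_bounded_support[where R = "2 * r"]) (auto intro!: continuous_intros ca simp: a'0)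
  have bd: "(a x, a y) \<in> {-1..1} \<times> {-1..1}" "(0::real, a x) \<in> {-1..1} \<times> {-1..1}" for x y
    using a1[of x] a1[of y] by (auto simp: abs_le_iff)
  have "\<omega> \<le> \<rho>\<^sup>2 * \<kappa> * (\<integral>x. (a' x)\<^sup>2 \<partial>lborel)"
    using large \<rho>(1,4) by (simp add: a'_def field_simps)
  also have "\<dots> = (\<integral>x. \<rho>\<^sup>2 * \<kappa> * (a' x)\<^sup>2 \<partial>lborel)" by simp
  also have "\<dots> \<le> (\<integral>x. g12 (a x, a x) * (a' x)\<^sup>2 \<partial>lborel)"
  proof (rule integral_mono)
    show "integrable lborel (\<lambda>x. g12 (a x, a x) * (a' x)\<^sup>2)"
      by (rule integrable_continuous_bounded_support[where R = "2 * r"])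
         (auto intro!: continuous_intros ca continuous_on_compose2[OF G12] simp: a'0 bd[simplified])
    show "\<rho>\<^sup>2 * \<kappa> * (a' x)\<^sup>2 \<le> g12 (a x, a x) * (a' x)\<^sup>2" for x
    proof (rule mult_right_mono)
      have "\<kappa> \<le> \<sigma> * h12 (ub + \<rho> * a x, vb + \<sigma> * \<rho> * a x)"
        using b\<rho>[OF a1[of x]] by (intro h12) auto
      from mult_left_mono[OF this, of "\<rho>\<^sup>2"] show "\<rho>\<^sup>2 * \<kappa> \<le> g12 (a x, a x)"
        by (simp add: g12_def power2_eq_square mult_ac)
    qed simp
  qed (use int_a' in simp)
  finally have c: "- (\<integral>x. g12 (a x, a x) * (a' x)\<^sup>2 \<partial>lborel) \<le> - \<omega>" by simp

  \<comment> \<open>Nested radii: \<open>a\<close> lives within \<open>2 * r\<close>, the plateau of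
    \<open>wv\<close> reaches to \<open>3 * r\<close> and its support to \<open>4 * r\<close>, the
    plateau of \<open>wu\<close> reaches to \<open>5 * r\<close> and its support to
    \<open>6 * r\<close>. Each gap of \<open>r\<close> absorbs a shift by less than
    \<open>r\<close>.\<close>
  define wu where "wu x = ub * cutoff (5 * r) (6 * r) x + \<rho> * a x" for x
  define wv where "wv x = vb * cutoff (3 * r) (4 * r) x + (\<sigma> * \<rho>) * a x" for x
  have wu1: "wu x = ub + \<rho> * a x" if "norm x \<le> 5 * r" for x
    using cutoff_eq_1[of "5 * r" "6 * r" x] r(1) that by (simp add: wu_def)
  have wv1: "wv x = vb + \<sigma> * \<rho> * a x" if "norm x \<le> 3 * r" for x
    using cutoff_eq_1[of "3 * r" "4 * r" x] r(1) that by (simp add: wv_def)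
  have wu0: "wu x = 0" if "6 * r \<le> norm x" for x
    using cutoff_eq_0[of "5 * r" "6 * r" x] a0[of x] r(1) that by (simp add: wu_def)
  have wv0: "wv x = 0" if "4 * r \<le> norm x" for x
    using cutoff_eq_0[of "3 * r" "4 * r" x] a0[of x] r(1) that by (simp add: wv_def)
  have wu0': "wu x = 0" and wv0': "wv x = 0" if "6 * r < norm x" for x
    using that r(1) by (auto intro!: wu0 wv0)
  have wu_nn: "0 \<le> wu x" for x
  proof (cases "norm x \<le> 2 * r")
    case True
    then show ?thesis using wu1[of x] b\<rho>(1)[OF a1[of x]] r(1) \<rho> by (simp add: abs_le_iff)
  next
    case False
    then show ?thesis using a0[of x] \<rho> cutoff_bounds(1)[of "5 * r" "6 * r" x] by (simp add: wu_def)
  qed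
  have wv_nn: "0 \<le> wv x" for x
  proof (cases "norm x \<le> 2 * r")
    case True
    then show ?thesis using wv1[of x] b\<rho>(2)[OF a1[of x]] r(1) \<rho> by (simp add: abs_le_iff)
  next
    case False
    then show ?thesis using a0[of x] \<rho> cutoff_bounds(1)[of "3 * r" "4 * r" x] by (simp add: wv_def)
  qed
  have swu: "smooth_on UNIV wu" and swv: "smooth_on UNIV wv"
    unfolding wu_def wv_def by (intro smooth_on_add smooth_on_mult smooth_on_const smooth_cutoff sa)+
  have mass: "(\<integral>x. w x \<partial>lborel) \<le> 1"
    if "smooth_on UNIV w" "\<And>x. w x \<le> 2 * (ub + vb)" "\<And>x. 6 * r \<le> norm x \<Longrightarrow> w x = 0" for w :: "'a \<Rightarrow> real"
  proof -
    have "(\<integral>x. w x \<partial>lborel) \<le> (\<integral>x. 2 * (ub + vb) * indicator (cball (0::'a) (6 * r)) x \<partial>lborel)"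
    proof (rule integral_mono)
      show "integrable lborel w"
        by (rule integrable_continuous_bounded_support[OF smooth_on_imp_continuous[OF that(1)], of "6 * r"])
           (use that(3) in auto)
      show "integrable lborel (\<lambda>x. 2 * (ub + vb) * indicator (cball (0::'a) (6 * r)) x)"
        by (intro integrable_mult_right integrable_real_indicator) (use emeasure_lborel_cball_finite in auto)
      show "w x \<le> 2 * (ub + vb) * indicator (cball 0 (6 * r)) x" for x
        using that(2,3)[of x] by (auto simp: indicator_def)
    qed
    also have "\<dots> \<le> 1" using r(3) by simp
    finally show ?thesis .
  qed
  have cut_le: "z * cutoff p q x \<le> z" if "0 < z" for z p q and x :: 'a
    using mult_left_mono[OF cutoff_bounds(2), of z p q x] that by simp
  have pos: "0 < ub" "0 < vb" using \<rho> by linarith+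
  have "wu x \<le> 2 * (ub + vb)" for x
  proof -
    have "wu x \<le> ub + \<rho>"
      unfolding wu_def by (intro add_mono cut_le pos b\<rho>(1)[OF a1, THEN abs_le_D1])
    then show ?thesis using pos \<rho> by simp
  qed
  moreover have "wv x \<le> 2 * (ub + vb)" for x
  proof -
    have "wv x \<le> vb + \<rho>"
      unfolding wv_def by (intro add_mono cut_le pos b\<rho>(2)[OF a1, THEN abs_le_D1])
    then show ?thesis using pos \<rho> by simp
  qed
  ultimately have mass': "(\<integral>x. wu x \<partial>lborel) \<le> 1" "(\<integral>x. wv x \<partial>lborel) \<le> 1"
    using r(1) by (auto intro!: mass swu swv wu0 wv0)
  \<comment> \<open>The mass bumps sit at distance 20 on opposite sides, while the patterns have
    radius at most 6 and shifts are below 1. So neither bump meets the other or the pattern of the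
    other species.\<close>
  obtain u R1 where u: "smooth_on UNIV u" "u \<in> density_P2" "\<And>x. 1 \<le> norm (x - 20 *\<^sub>R e) \<Longrightarrow> u x = wu x"
    "\<And>x. R1 < norm x \<Longrightarrow> u x = 0"
  proof -
    show thesis
      by (rule complete_to_density[of wu "6 * r" "20 *\<^sub>R e"]) (fact swu wu_nn wu0' mass' that)+
  qed
  obtain v R2 where v: "smooth_on UNIV v" "v \<in> density_P2" "\<And>x. 1 \<le> norm (x - (- 20) *\<^sub>R e) \<Longrightarrow> v x = wv x"
    "\<And>x. R2 < norm x \<Longrightarrow> v x = 0"
  proof -
    show thesis
      by (rule complete_to_density[of wv "6 * r" "(- 20) *\<^sub>R e"]) (fact swv wv_nn wv0' mass' that)+
  qed
  note cu = smooth_on_imp_continuous[OF u(1)] and cv = smooth_on_imp_continuous[OF v(1)]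
  note h0 = coupling_term_boundary[OF cp]
  have nn: "0 \<le> u x" "0 \<le> v x" for x using u(2) v(2) by (simp_all add: density_P2_def)
  \<comment> \<open>The difference between the true and the model integrand does not depend on
    \<open>s\<close>. Within \<open>3 * r\<close> it is \<open>g (0, a x)\<close>; between
    \<open>3 * r\<close> and \<open>4 * r\<close> the density \<open>u\<close> equals
    \<open>ub\<close> before and after the shift, and \<open>a\<close> vanishes; farther out
    \<open>v\<close> vanishes, or \<open>u\<close> vanishes at both points.\<close>
  have split: "h (u (x - s *\<^sub>R e), v x) - (g (a (x - s *\<^sub>R e), a x) - g (0, a x))
      = h (u x, v x) - (g (a x, a x) - g (0, a x))" if s: "\<bar>s\<bar> < r" for s x
  proof -
    have n: "norm (x - s *\<^sub>R e) < norm x + r" "norm x - r < norm (x - s *\<^sub>R e)"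
      using norm_triangle_ineq4[of x "s *\<^sub>R e"] norm_triangle_ineq2[of x "s *\<^sub>R e"] s e by auto
    show ?thesis
    proof (cases "norm x \<le> 10")
      case True
      have "1 \<le> norm (x - (- 20) *\<^sub>R e)"
        using True e norm_triangle_ineq2[of "(- 20) *\<^sub>R e" x] by (simp add: norm_minus_commute)
      then have vx: "v x = wv x" by (rule v(3))
      have "1 \<le> norm ((x - s *\<^sub>R e) - 20 *\<^sub>R e)"
        using True e n r norm_triangle_ineq2[of "20 *\<^sub>R e" "x - s *\<^sub>R e"] by (simp add: norm_minus_commute)
      then have us: "u (x - s *\<^sub>R e) = wu (x - s *\<^sub>R e)" by (rule u(3))
      have "1 \<le> norm (x - 20 *\<^sub>R e)"
        using True e norm_triangle_ineq2[of "20 *\<^sub>R e" x] by (simp add: norm_minus_commute)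
      then have ux: "u x = wu x" by (rule u(3))
      show ?thesis
      proof (cases "norm x \<le> 3 * r")
        case True
        then show ?thesis
          using n r wv1[of x] wu1[of x] wu1[of "x - s *\<^sub>R e"] by (simp add: vx us ux g_def)
      next
        case False
        then have a: "a x = 0" "a (x - s *\<^sub>R e) = 0" using n r by (auto intro!: a0)
        show ?thesis
        proof (cases "norm x \<le> 4 * r")
          case True
          then have "wu x = ub" "wu (x - s *\<^sub>R e) = ub"
            using n r wu1[of x] wu1[of "x - s *\<^sub>R e"] a by simp_all
          then show ?thesis by (simp add: a us ux)
        next
          case False
          then have "v x = 0" using vx wv0 by simp
          then show ?thesis using h0(2) nn by (simp add: a)
        qed
      qed
    next
      case False
      then have a: "a x = 0" "a (x - s *\<^sub>R e) = 0" using n r by (auto intro!: a0)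
      show ?thesis
      proof (cases "1 \<le> norm (x - (- 20) *\<^sub>R e)")
        case True
        then have "v x = 0" using v(3)[OF True] wv0[of x] r \<open>\<not> norm x \<le> 10\<close> by simp
        then show ?thesis using h0(2) nn by (simp add: a)
      next
        case near: False
        \<comment> \<open>Here \<open>x\<close> lies near the bump of \<open>v\<close>, whose centre
          is 40 away from that of \<open>u\<close>. The claim is used for \<open>y = x\<close> and
          for the shifted point.\<close>
        have z: "u y = 0" if "norm (x - y) \<le> 1" for y
        proof -
          have "(x - (- 20) *\<^sub>R e) - (x - y) - (y - 20 *\<^sub>R e) = 40 *\<^sub>R e"
            by (simp add: algebra_simps flip: scaleR_left_distrib)
          then have "40 * norm e = norm ((x - (- 20) *\<^sub>R e) - (x - y) - (y - 20 *\<^sub>R e))"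
            by simp
          also have "\<dots> \<le> norm (x - (- 20) *\<^sub>R e) + norm (x - y) + norm (y - 20 *\<^sub>R e)"
            by (intro order_trans[OF norm_triangle_ineq4] add_mono norm_triangle_ineq4 order_refl)
          finally have "u y = wu y" using near that e by (intro u(3)) simp
          moreover have "6 * r \<le> norm y"
            using norm_triangle_ineq2[of x "x - y"] that r \<open>\<not> norm x \<le> 10\<close> by simp
          ultimately show ?thesis using wu0 by simp
        qed
        have "u x = 0" "u (x - s *\<^sub>R e) = 0" using s r e by (auto intro!: z)
        then show ?thesis using h0(1) nn by (simp add: a)
      qed
    qed
  qed
  \<comment> \<open>The \<open>s\<close>-independent remainder; its integral is a constant, which
    drops out of all derivatives in \<open>s\<close>.\<close>
  define k where "k x = h (u x, v x) - (g (a x, a x) - g (0, a x))" for x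
  have cga: "continuous_on UNIV (\<lambda>x. g (a (x - s *\<^sub>R e), a x) - g (0, a x))" for s
    using bd by (intro continuous_intros continuous_on_compose2[OF G0] continuous_on_compose2[OF ca(1)]) auto
  have ig: "integrable lborel (\<lambda>x. g (a (x - s *\<^sub>R e), a x) - g (0, a x))" for s
  proof (rule integrable_continuous_bounded_support[OF cga, where R = "2 * r + \<bar>s\<bar>"])
    fix x :: 'a assume "2 * r + \<bar>s\<bar> < norm x"
    then have "a (x - s *\<^sub>R e) = 0"
      using norm_triangle_ineq2[of x "s *\<^sub>R e"] e by (intro a0) auto
    then show "g (a (x - s *\<^sub>R e), a x) - g (0, a x) = 0" by simp
  qed
  have ih: "integrable lborel (\<lambda>x. h (u x, v x))"
    by (rule integrable_coupling[OF cp cu cv nn v(4)])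
  have ik: "integrable lborel k"
    using Bochner_Integration.integrable_diff[OF ih ig[of 0]] by (simp add: k_def[abs_def])
  have hs: "(\<integral>x. h (u (x - s *\<^sub>R e), v x) \<partial>lborel)
      = (\<integral>x. k x \<partial>lborel) + (\<integral>x. g (a (x - s *\<^sub>R e), a x) - g (0, a x) \<partial>lborel)" if "\<bar>s\<bar> < r" for s
  proof -
    have "h (u (x - s *\<^sub>R e), v x) = k x + (g (a (x - s *\<^sub>R e), a x) - g (0, a x))" for x
      using split[OF that, of x] by (simp add: k_def)
    then show ?thesis
      by (simp only: Bochner_Integration.integral_add[OF ik ig])
  qed
  have "((\<lambda>s. \<integral>x. h (u (x - s *\<^sub>R e), v x) \<partial>lborel) has_real_derivative f' s) (at s)" if "\<bar>s\<bar> < r" for s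
  proof (rule has_field_derivative_transform_within_open[where S = "{- r<..<r}"])
    show "((\<lambda>s. (\<integral>x. k x \<partial>lborel) + (\<integral>x. g (a (x - s *\<^sub>R e), a x) - g (0, a x) \<partial>lborel))
        has_real_derivative f' s) (at s)"
      using DERIV_add[OF DERIV_const f'[of s]] by simp
    show "(\<integral>x. k x \<partial>lborel) + (\<integral>x. g (a (x - t *\<^sub>R e), a x) - g (0, a x) \<partial>lborel)
        = (\<integral>x. h (u (x - t *\<^sub>R e), v x) \<partial>lborel)" if "t \<in> {- r<..<r}" for t
      using hs[of t] that by auto
  qed (use that in auto)
  then show thesis
    using that[of u v "max R1 R2" r f'] u v f'' c r(1) by auto
qed

section \<open>Failure of convexity\<close>

lemma ereal_convex_on_real:
  assumes "ereal_convex_on S (\<lambda>s. ereal (f s))" "convex S"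
  shows "convex_on S f"
  using assms by (intro convex_onI) (force simp: ereal_convex_on_def)+

text \<open>Convexity is available only to the right of 0. There \<open>k'\<close> is monotone, and
  its continuity at 0 extends this to the end point, so the right difference quotients of
  \<open>k'\<close> at 0 are nonnegative.\<close>

lemma convex_on_second_derivative_nonneg:
  fixes k k' :: "real \<Rightarrow> real"
  assumes cv: "convex_on {0..1} k" and r: "0 < r"
    and D: "\<And>s. \<bar>s\<bar> < r \<Longrightarrow> (k has_real_derivative k' s) (at s)"
    and D': "(k' has_real_derivative c) (at 0)"
  shows "0 \<le> c"
proof -
  define d where "d = min r 1"
  have d: "0 < d" using r by (simp add: d_def)
  have mono: "k' t \<le> k' s" if "0 < t" "t < s" "s < d" for s t
  proof -
    have "k' t * (s - t) \<le> k s - k t" "k' s * (t - s) \<le> k t - k s"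
      using that by (auto intro!: convex_on_imp_above_tangent[OF cv] has_field_derivative_at_within D
          simp: d_def interior_atLeastAtMost_real)
    then have "k' t * (s - t) \<le> k' s * (s - t)" by (simp add: algebra_simps)
    then show ?thesis using that by simp
  qed
  have k'0: "(k' \<longlongrightarrow> k' 0) (at_right 0)"
    using DERIV_isCont[OF D'] by (simp add: isCont_def filterlim_at_split)
  have "k' 0 \<le> k' s" if s: "0 < s" "s < d" for s
  proof (rule tendsto_upperbound[OF k'0])
    show "\<forall>\<^sub>F t in at_right 0. k' t \<le> k' s"
      unfolding eventually_at_right_field using s mono by (intro exI[of _ s]) auto
  qed simp
  then have "\<forall>\<^sub>F s in at_right 0. 0 \<le> (k' s - k' 0) / s"
    unfolding eventually_at_right_field using d by (intro exI[of _ d]) auto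
  moreover have "((\<lambda>s. (k' s - k' 0) / s) \<longlongrightarrow> c) (at_right 0)"
    using D' by (simp add: DERIV_def filterlim_at_split)
  ultimately show ?thesis by (intro tendsto_lowerbound) auto
qed

text \<open>Moving the shift onto the potential,
  \<open>M / 2 * s\<^sup>2 - \<Phi> (x + s *\<^sub>R e)\<close> is convex in \<open>s\<close> by the
  upper Hessian bound. Integrating against the probability density \<open>u\<close> preserves
  convexity, and no derivative of the integral is required.\<close>

lemma potential_translation_semiconcave:
  fixes \<Phi> u :: "'a::euclidean_space \<Rightarrow> real"
  assumes pot: "potential \<Lambda> M \<Phi>" and e: "norm e = 1"
    and u: "continuous_on UNIV u" "\<And>x. 0 \<le> u x" "\<And>x. R < norm x \<Longrightarrow> u x = 0" "(\<integral>x. u x \<partial>lborel) = 1"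
  shows "convex_on UNIV (\<lambda>s. M / 2 * s\<^sup>2 - (\<integral>x. u (x - s *\<^sub>R e) * \<Phi> x \<partial>lborel))"
proof -
  have s\<Phi>: "smooth_on UNIV \<Phi>" and hess: "\<And>x. hessian \<Phi> x e e \<le> M * (e \<bullet> e)"
    using pot by (auto simp: potential_def)
  have c\<Phi>: "continuous_on UNIV \<Phi>" by (rule smooth_on_imp_continuous[OF s\<Phi>])
  define q where "q s x = M / 2 * s\<^sup>2 - \<Phi> (x + s *\<^sub>R e)" for s x
  have cq: "convex_on UNIV (\<lambda>s. q s x)" for x
  proof (rule f''_ge0_imp_convex)
    show "((\<lambda>s. q s x) has_real_derivative M * s - frechet_derivative \<Phi> (at (x + s *\<^sub>R e)) e) (at s)" for s
      unfolding q_def by (rule smooth_on_DERIV_line[OF s\<Phi>] derivative_eq_intros refl)+ simp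
    show "((\<lambda>s. M * s - frechet_derivative \<Phi> (at (x + s *\<^sub>R e)) e) has_real_derivative
        M - hessian \<Phi> (x + s *\<^sub>R e) e e) (at s)" for s
      unfolding hessian_def by (rule smooth_on_DERIV_line[OF smooth_onD(2)[OF s\<Phi>]] derivative_eq_intros refl)+ simp
    show "0 \<le> M - hessian \<Phi> (x + s *\<^sub>R e) e e" for s
      using hess[of "x + s *\<^sub>R e"] e by (simp add: dot_square_norm)
  qed simp
  have cc: "continuous_on UNIV (\<lambda>x. u x * q s x)" for s
    unfolding q_def by (intro continuous_intros u continuous_on_compose2[OF c\<Phi>]) auto
  have iq: "integrable lborel (\<lambda>x. u x * q s x)" for s
    by (rule integrable_continuous_bounded_support[OF cc]) (use u(3) in auto)
  have iu: "integrable lborel u"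
    by (rule integrable_continuous_bounded_support[OF u(1,3)])
  have c1: "continuous_on UNIV (\<lambda>x. u x * \<Phi> (x + s *\<^sub>R e))" for s
    by (intro continuous_intros u continuous_on_compose2[OF c\<Phi>]) auto
  have i1: "integrable lborel (\<lambda>x. u x * \<Phi> (x + s *\<^sub>R e))" for s
    by (rule integrable_continuous_bounded_support[OF c1]) (use u(3) in auto)
  have eq: "(\<integral>x. u x * q s x \<partial>lborel) = M / 2 * s\<^sup>2 - (\<integral>x. u (x - s *\<^sub>R e) * \<Phi> x \<partial>lborel)" for s
  proof -
    have "(\<integral>x. u (x - s *\<^sub>R e) * \<Phi> x \<partial>lborel) = (\<integral>x. u x * \<Phi> (x + s *\<^sub>R e) \<partial>lborel)"
      using integral_lborel_shift(1)[OF borel_measurable_continuous_onI[OF c1[of s]], of "- (s *\<^sub>R e)"] by simp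
    moreover have "(\<integral>x. u x * q s x \<partial>lborel)
        = (\<integral>x. (M / 2 * s\<^sup>2) * u x - u x * \<Phi> (x + s *\<^sub>R e) \<partial>lborel)"
      by (simp add: q_def algebra_simps)
    ultimately show ?thesis
      using i1 iu u(4) by (simp add: Bochner_Integration.integral_diff)
  qed
  have "convex_on UNIV (\<lambda>s. \<integral>x. u x * q s x \<partial>lborel)"
  proof (rule convex_onI)
    fix t x y :: real assume t: "0 < t" "t < 1"
    have "(\<integral>z. u z * q ((1 - t) *\<^sub>R x + t *\<^sub>R y) z \<partial>lborel)
        \<le> (\<integral>z. (1 - t) * (u z * q x z) + t * (u z * q y z) \<partial>lborel)"
    proof (rule integral_mono)
      show "u z * q ((1 - t) *\<^sub>R x + t *\<^sub>R y) z \<le> (1 - t) * (u z * q x z) + t * (u z * q y z)" for z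
        using mult_left_mono[OF convex_onD[OF cq[of z], of t x y] u(2)[of z]] t by (simp add: algebra_simps)
    qed (auto intro!: iq Bochner_Integration.integrable_add integrable_mult_right)
    also have "\<dots> = (1 - t) * (\<integral>z. u z * q x z \<partial>lborel) + t * (\<integral>z. u z * q y z \<partial>lborel)"
      using iq by (simp add: Bochner_Integration.integral_add)
    finally show "(\<integral>z. u z * q ((1 - t) *\<^sub>R x + t *\<^sub>R y) z \<partial>lborel)
        \<le> (1 - t) * (\<integral>z. u z * q x z \<partial>lborel) + t * (\<integral>z. u z * q y z \<partial>lborel)" .
  qed simp
  then show ?thesis by (simp add: eq)
qed

text \<open>The second component stands still and contributes \<open>W2 v v = 0\<close>, which is
  the case of zero shifts in \<open>W2_translates\<close>. The first moves at unit speed.\<close>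

lemma geodesic_translation:
  fixes u v :: "'a::euclidean_space \<Rightarrow> real"
  assumes u: "u \<in> density_P2" and v: "v \<in> density_P2" and e: "norm e = 1"
  shows "geodesic (\<lambda>s. (push_forward (\<lambda>x. x + s *\<^sub>R e) u, v))"
    and "W2_pair (push_forward (\<lambda>x. x + s *\<^sub>R e) u, v) (push_forward (\<lambda>x. x + t *\<^sub>R e) u, v) = \<bar>s - t\<bar>"
proof -
  have mu: "measure_of_density (push_forward (\<lambda>x. x + s *\<^sub>R e) u) = measure_of_density (\<lambda>x. u (x - s *\<^sub>R e))" for s
    using u by (intro measure_of_density_push_forward) (auto simp: density_P2_def)
  have mv: "measure_of_density v = measure_of_density (\<lambda>x. v (x - 0 *\<^sub>R e))"
    by (simp only: scaleR_zero_left diff_zero)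
  have "W2 v v = 0" unfolding W2_translates[OF v e mv mv] by (simp only: diff_self abs_zero)
  then have W: "W2_pair (push_forward (\<lambda>x. x + s *\<^sub>R e) u, v) (push_forward (\<lambda>x. x + t *\<^sub>R e) u, v) = \<bar>s - t\<bar>" for s t
    unfolding W2_pair_def fst_conv snd_conv W2_translates[OF u e mu mu] by simp
  then show "W2_pair (push_forward (\<lambda>x. x + s *\<^sub>R e) u, v) (push_forward (\<lambda>x. x + t *\<^sub>R e) u, v) = \<bar>s - t\<bar>" .
  show "geodesic (\<lambda>s. (push_forward (\<lambda>x. x + s *\<^sub>R e) u, v))"
    using push_forward_shift_in_density_P2[OF u] v unfolding geodesic_def W by simp
qed

section \<open>Energies along a translation\<close>

lemma nonlinearity_continuous: "nonlinearity D m F \<Longrightarrow> continuous_on {0..} F"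
  and nonlinearity_0: "nonlinearity D m F \<Longrightarrow> F 0 = 0"
  by (auto simp: nonlinearity_def C1_on_def differentiable_imp_continuous_on)

text \<open>The integrals of \<open>F\<close> and \<open>G\<close> are unaffected by the shift, so
  the dependence on \<open>c\<close> is entirely in the coupling. The third claim restates
  integrability for the pointwise translate, to which \<open>push_forward\<close> is equal only
  almost everywhere.\<close>

lemma internal_energy_translation:
  fixes u v :: "'a::euclidean_space \<Rightarrow> real"
  assumes F: "nonlinearity D m F" and G: "nonlinearity D n G" and cp: "coupling_term \<epsilon>s F G h"
    and u: "u \<in> density_P2" "continuous_on UNIV u" "\<And>x. R < norm x \<Longrightarrow> u x = 0"
    and v: "v \<in> density_P2" "continuous_on UNIV v" "\<And>x. R < norm x \<Longrightarrow> v x = 0"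
  shows "integrable lborel (\<lambda>x. H F G h \<epsilon> (push_forward (\<lambda>x. x + c) u x) (v x))"
    and "(\<integral>x. H F G h \<epsilon> (push_forward (\<lambda>x. x + c) u x) (v x) \<partial>lborel)
      = (\<integral>x. F (u x) \<partial>lborel) + (\<integral>x. G (v x) \<partial>lborel) + \<epsilon> * (\<integral>x. h (u (x - c), v x) \<partial>lborel)"
    and "integrable lborel (\<lambda>x. H F G h \<epsilon> (u (x - c)) (v x))"
proof -
  let ?p = "push_forward (\<lambda>x. x + c) u"
  have nn: "0 \<le> u x" "0 \<le> v x" "0 \<le> ?p x" for x
    using u(1) v(1) push_forward_shift_in_density_P2[OF u(1)] by (auto simp: density_P2_def)
  have [measurable]: "u \<in> borel_measurable borel" "v \<in> borel_measurable borel"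
    using u(1) v(1) by (simp_all add: density_P2_def)
  have int: "integrable lborel (\<lambda>x. N (w x))"
    if "continuous_on {0..} N" "N 0 = 0" "continuous_on UNIV w" "\<And>x. 0 \<le> w x" "\<And>x. R < norm x \<Longrightarrow> w x = 0"
    for N :: "real \<Rightarrow> real" and w :: "'a \<Rightarrow> real"
    using that by (intro integrable_continuous_bounded_support[where R = R] continuous_on_compose2[OF that(1)]) auto
  have iF0: "integrable lborel (\<lambda>x. F (u x))"
    by (rule int[OF nonlinearity_continuous[OF F] nonlinearity_0[OF F] u(2) nn(1) u(3)])
  have iG: "integrable lborel (\<lambda>x. G (v x))"
    by (rule int[OF nonlinearity_continuous[OF G] nonlinearity_0[OF G] v(2) nn(2) v(3)])
  have mF: "(\<lambda>x. F (u x)) \<in> borel_measurable borel" using iF0 by (simp add: borel_measurable_integrable[of lborel, simplified])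
  note iF = integral_lborel_shift[OF mF, of "- c", simplified]
  have ih: "integrable lborel (\<lambda>x. h (u (x - c), v x))"
    using u(2) v(2,3) nn
    by (intro integrable_coupling[OF cp]) (auto intro!: continuous_on_compose2[OF u(2)] continuous_intros)
  have ic: "integrable lborel (\<lambda>x. H F G h \<epsilon> (u (x - c)) (v x))"
    using iF0 iF(2) iG ih by (simp add: H_def)
  then show "integrable lborel (\<lambda>x. H F G h \<epsilon> (u (x - c)) (v x))" .
  have eq: "(\<integral>x. H F G h \<epsilon> (u (x - c)) (v x) \<partial>lborel)
      = (\<integral>x. F (u x) \<partial>lborel) + (\<integral>x. G (v x) \<partial>lborel) + \<epsilon> * (\<integral>x. h (u (x - c), v x) \<partial>lborel)"
    using iF0 iF iG ih by (simp add: H_def)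
  have ae: "AE x in lborel. H F G h \<epsilon> (?p x) (v x) = H F G h \<epsilon> (u (x - c)) (v x)"
    using push_forward_shift_AE[of u c] nn(1) by (auto elim: AE_mp)
  have m: "(\<lambda>x. H F G h \<epsilon> (?p x) (v x)) \<in> borel_measurable lborel"
  proof -
    \<comment> \<open>Continuity of \<open>F\<close>, \<open>G\<close> and \<open>h\<close> is known
      only for nonnegative arguments. Truncating at 0 gives a function continuous on the whole
      plane, hence Borel, with the same values here.\<close>
    define K where "K z = F (max 0 (fst z)) + G (max 0 (snd z)) + \<epsilon> * h (max 0 (fst z), max 0 (snd z))"
      for z :: "real \<times> real"
    have "continuous_on UNIV K" unfolding K_def
      by (intro continuous_intros continuous_on_compose2[OF nonlinearity_continuous[OF F]]
          continuous_on_compose2[OF nonlinearity_continuous[OF G]]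
          continuous_on_compose2[OF coupling_term_continuous[OF cp]]) auto
    then have [measurable]: "K \<in> borel_measurable borel" by (rule borel_measurable_continuous_onI)
    have "(\<lambda>x. K (?p x, v x)) \<in> borel_measurable lborel" by measurable
    moreover have "K (?p x, v x) = H F G h \<epsilon> (?p x) (v x)" for x
      using nn by (simp add: K_def H_def max_def)
    ultimately show ?thesis by simp
  qed
  show "integrable lborel (\<lambda>x. H F G h \<epsilon> (?p x) (v x))"
    using ic integrable_cong_AE[OF m borel_measurable_integrable[OF ic] ae] by simp
  show "(\<integral>x. H F G h \<epsilon> (?p x) (v x) \<partial>lborel)
      = (\<integral>x. F (u x) \<partial>lborel) + (\<integral>x. G (v x) \<partial>lborel) + \<epsilon> * (\<integral>x. h (u (x - c), v x) \<partial>lborel)"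
    using integral_cong_AE[OF m borel_measurable_integrable[OF ic] ae] eq by simp
qed

text \<open>For continuous densities of bounded support all three contributions are integrable, so
  the extended integral is finite and splits.\<close>

lemma energy_translation:
  fixes u v :: "'a::euclidean_space \<Rightarrow> real"
  assumes F: "nonlinearity D m F" and G: "nonlinearity D n G" and cp: "coupling_term \<epsilon>s F G h"
    and u: "u \<in> density_P2" "continuous_on UNIV u" "\<And>x. R < norm x \<Longrightarrow> u x = 0"
    and v: "v \<in> density_P2" "continuous_on UNIV v" "\<And>x. R < norm x \<Longrightarrow> v x = 0"
    and c\<Phi>: "continuous_on UNIV \<Phi>" and c\<Psi>: "continuous_on UNIV \<Psi>"
  shows "energy F G h \<Phi> \<Psi> \<epsilon> (push_forward (\<lambda>x. x + c) u, v) =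
    ereal ((\<integral>x. H F G h \<epsilon> (push_forward (\<lambda>x. x + c) u x) (v x) \<partial>lborel)
      + (\<integral>x. u (x - c) * \<Phi> x \<partial>lborel) + (\<integral>x. v x * \<Psi> x \<partial>lborel))"
proof -
  let ?p = "push_forward (\<lambda>x. x + c) u"
  note I = internal_energy_translation[OF F G cp u v, where \<epsilon> = \<epsilon> and c = c]
  have nn: "0 \<le> u x" for x using u(1) by (simp add: density_P2_def)
  have um: "u \<in> borel_measurable borel" using u(1) by (simp add: density_P2_def)
  have ae: "AE x in lborel. ?p x = u (x - c)" by (rule push_forward_shift_AE[OF um nn])
  have "continuous_on UNIV (\<lambda>x. u (x - c) * \<Phi> x)"
    by (intro continuous_intros c\<Phi> continuous_on_compose2[OF u(2)]) auto
  then have i\<Phi>: "integrable lborel (\<lambda>x. u (x - c) * \<Phi> x)"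
  proof (rule integrable_continuous_bounded_support)
    fix x :: 'a assume "R + norm c < norm x"
    then show "u (x - c) * \<Phi> x = 0" using norm_triangle_ineq2[of x c] by (simp add: u(3))
  qed
  have i\<Psi>: "integrable lborel (\<lambda>x. v x * \<Psi> x)"
    by (rule integrable_continuous_bounded_support[where R = R]) (auto intro!: continuous_intros v c\<Psi>)
  have "energy F G h \<Phi> \<Psi> \<epsilon> (?p, v) = ext_integral (\<lambda>x. H F G h \<epsilon> (u (x - c)) (v x) + u (x - c) * \<Phi> x + v x * \<Psi> x)"
    unfolding energy_def by (simp, rule ext_integral_cong_AE) (use ae in \<open>auto elim: AE_mp\<close>)
  also have "\<dots> = ereal (\<integral>x. H F G h \<epsilon> (u (x - c)) (v x) + u (x - c) * \<Phi> x + v x * \<Psi> x \<partial>lborel)"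
    by (intro ext_integral_eq_integral Bochner_Integration.integrable_add I(3) i\<Phi> i\<Psi>)
  also have "(\<integral>x. H F G h \<epsilon> (u (x - c)) (v x) + u (x - c) * \<Phi> x + v x * \<Psi> x \<partial>lborel)
      = (\<integral>x. H F G h \<epsilon> (u (x - c)) (v x) \<partial>lborel) + (\<integral>x. u (x - c) * \<Phi> x \<partial>lborel) + (\<integral>x. v x * \<Psi> x \<partial>lborel)"
    using I(3) i\<Phi> i\<Psi> by simp
  also have "(\<integral>x. H F G h \<epsilon> (u (x - c)) (v x) \<partial>lborel) = (\<integral>x. H F G h \<epsilon> (?p x) (v x) \<partial>lborel)"
    by (rule integral_cong_AE[OF borel_measurable_integrable[OF I(3)] borel_measurable_integrable[OF I(1)]])
       (use ae in \<open>auto elim: AE_mp\<close>)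
  finally show ?thesis .
qed

theorem proposition2p4:
  fixes \<Phi> \<Psi> :: "real ^ 'd \<Rightarrow> real"
    and F G :: "real \<Rightarrow> real"
    and h :: "real \<times> real \<Rightarrow> real"
    and \<Lambda> M D m n \<epsilon>s \<epsilon> :: real
    and first :: 'd
  assumes "\<Lambda> > 0" and "M > 0"
    and "potential \<Lambda> M \<Phi>" and "potential \<Lambda> M \<Psi>"
    and "nonlinearity D m F" and "nonlinearity D n G"
    and "coupling_term \<epsilon>s F G h"
    and "\<exists>p\<in>quadrant. h p \<noteq> 0"
    and "\<epsilon> > 0"
  shows "(\<nexists>lam :: real. convex_along_geodesics lam (energy F G h \<Phi> \<Psi> \<epsilon>)) \<and>
    (\<exists>C>0. \<forall>\<omega>>0. \<exists>u v :: real ^ 'd \<Rightarrow> real.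
       u \<in> density_P2 \<and> smooth_on UNIV u \<and> v \<in> density_P2 \<and> smooth_on UNIV v \<and>
       (let T = (\<lambda>s x. x + s *\<^sub>R axis first 1);
            f = (\<lambda>s x. H F G h \<epsilon> (push_forward (T s) u x) (v x))
        in (\<forall>s\<ge>0. integrable lborel (f s)) \<and>
           (\<exists>c. has_second_derivative_within (\<lambda>s. \<integral>x. f s x \<partial>lborel) c 0 {0..} \<and>
                c \<le> - C * (\<omega> - 1))))"
proof -
  define e :: "real ^ 'd" where "e = axis first 1"
  have e: "norm e = 1" by (simp add: e_def norm_axis_1)
  define J where "J u v s = (\<integral>x. H F G h \<epsilon> (push_forward (\<lambda>x. x + s *\<^sub>R e) u x) (v x) \<partial>lborel)"
    for u v :: "real ^ 'd \<Rightarrow> real" and s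
  \<comment> \<open>One construction, valid for every real \<open>\<omega>\<close>, serves both
    claims. The coupling enters with weight \<open>\<epsilon>\<close>, so it is applied with
    \<open>\<omega> / \<epsilon>\<close>.\<close>
  have ex: "\<exists>u v R r c J'. u \<in> density_P2 \<and> v \<in> density_P2 \<and> smooth_on UNIV u \<and> smooth_on UNIV v \<and>
      (\<forall>x. R < norm x \<longrightarrow> u x = 0) \<and> (\<forall>x. R < norm x \<longrightarrow> v x = 0) \<and> 0 < r \<and>
      (\<forall>s. \<bar>s\<bar> < r \<longrightarrow> (J u v has_real_derivative J' s) (at s)) \<and>
      (J' has_real_derivative c) (at 0) \<and> c \<le> - \<omega> \<and>
      (\<forall>s. integrable lborel (\<lambda>x. H F G h \<epsilon> (push_forward (\<lambda>x. x + s *\<^sub>R e) u x) (v x)))" for \<omega>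
  proof -
    obtain u v :: "real ^ 'd \<Rightarrow> real" and R r f' c where
      uv: "u \<in> density_P2" "v \<in> density_P2" "smooth_on UNIV u" "smooth_on UNIV v"
      "\<And>x. R < norm x \<Longrightarrow> u x = 0" "\<And>x. R < norm x \<Longrightarrow> v x = 0" "0 < r" and
      f': "\<And>s. \<bar>s\<bar> < r \<Longrightarrow> ((\<lambda>s. \<integral>x. h (u (x - s *\<^sub>R e), v x) \<partial>lborel) has_real_derivative f' s) (at s)" and
      f'': "(f' has_real_derivative c) (at 0)" and c: "c \<le> - (\<omega> / \<epsilon>)"
    proof -
      show thesis
        by (rule oscillating_densities[OF assms(7,8) e, where \<omega> = "\<omega> / \<epsilon>"]) (fact that)
    qed
    note I = internal_energy_translation[OF assms(5,6,7) uv(1) smooth_on_imp_continuous[OF uv(3)] uv(5)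
        uv(2) smooth_on_imp_continuous[OF uv(4)] uv(6), where \<epsilon> = \<epsilon>]
    have "J u v = (\<lambda>s. (\<integral>x. F (u x) \<partial>lborel) + (\<integral>x. G (v x) \<partial>lborel) + \<epsilon> * (\<integral>x. h (u (x - s *\<^sub>R e), v x) \<partial>lborel))"
      unfolding J_def using I(2) by (intro ext) simp
    then have J1: "(J u v has_real_derivative \<epsilon> * f' s) (at s)" if "\<bar>s\<bar> < r" for s
      using DERIV_add[OF DERIV_const DERIV_cmult[OF f'[OF that], of \<epsilon>]] by simp
    have J2: "((\<lambda>s. \<epsilon> * f' s) has_real_derivative \<epsilon> * c) (at 0)"
      by (rule DERIV_cmult[OF f''])
    have c': "\<epsilon> * c \<le> - \<omega>"
      using c assms(9) by (simp add: field_simps)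
    have I1: "integrable lborel (\<lambda>x. H F G h \<epsilon> (push_forward (\<lambda>x. x + s *\<^sub>R e) u x) (v x))" for s
      by (rule I(1))
    show ?thesis
      by (rule exI[of _ u], rule exI[of _ v], rule exI[of _ R], rule exI[of _ r], rule exI[of _ "\<epsilon> * c"],
          rule exI[of _ "\<lambda>s. \<epsilon> * f' s"], intro conjI allI impI) (fact uv J1 J2 c' I1)+
  qed
  have "\<not> convex_along_geodesics lam (energy F G h \<Phi> \<Psi> \<epsilon>)" for lam
  proof
    assume conv: "convex_along_geodesics lam (energy F G h \<Phi> \<Psi> \<epsilon>)"
    \<comment> \<open>Along the translation, \<open>lam\<close>-convexity contributes
      \<open>- lam\<close> to the second derivative and the potential at most \<open>M\<close>. The
      choice \<open>M - lam + 1\<close> makes the total at most -1.\<close>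
    obtain u v R r c J' where
      uv: "u \<in> density_P2" "v \<in> density_P2" "smooth_on UNIV u" "smooth_on UNIV v"
      "\<And>x. R < norm x \<Longrightarrow> u x = 0" "\<And>x. R < norm x \<Longrightarrow> v x = 0" and r: "0 < r" and
      J': "\<And>s. \<bar>s\<bar> < r \<Longrightarrow> (J u v has_real_derivative J' s) (at s)" and
      J'': "(J' has_real_derivative c) (at 0)" and c: "c \<le> - (M - lam + 1)"
      using ex[of "M - lam + 1"] by blast
    have sm: "smooth_on UNIV \<Phi>" "smooth_on UNIV \<Psi>" using assms(3,4) by (auto simp: potential_def)
    note cont = uv(3,4)[THEN smooth_on_imp_continuous] sm[THEN smooth_on_imp_continuous]
    define P where "P s = (\<integral>x. u (x - s *\<^sub>R e) * \<Phi> x \<partial>lborel)" for s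
    define Q where "Q = (\<integral>x. v x * \<Psi> x \<partial>lborel)"
    have E: "energy F G h \<Phi> \<Psi> \<epsilon> (push_forward (\<lambda>x. x + s *\<^sub>R e) u, v) = ereal (J u v s + P s + Q)" for s
      unfolding J_def P_def Q_def
      by (rule energy_translation[OF assms(5,6,7) uv(1) cont(1) uv(5) uv(2) cont(2) uv(6) cont(3,4)])
    have "ereal_convex_on {0..1} (\<lambda>s. ereal (J u v s + P s + Q + lam / 2 * s * (1 - s)))"
      using conv[unfolded convex_along_geodesics_def, THEN spec, THEN mp, OF geodesic_translation(1)[OF uv(1,2) e]]
      unfolding E geodesic_translation(2)[OF uv(1,2) e] by simp
    then have cv1: "convex_on {0..1} (\<lambda>s. J u v s + P s + Q + lam / 2 * s * (1 - s))"
      by (rule ereal_convex_on_real) simp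
    \<comment> \<open>Adding this convex function cancels the potential term \<open>P\<close> and
      leaves a quadratic, so only \<open>J\<close> has to be differentiated twice.\<close>
    have "convex_on UNIV (\<lambda>s. M / 2 * s\<^sup>2 - P s)"
      unfolding P_def using uv(1)
      by (intro potential_translation_semiconcave[OF assms(3) e cont(1) _ uv(5)]) (auto simp: density_P2_def)
    then have "convex_on {0..1} (\<lambda>s. M / 2 * s\<^sup>2 - P s)"
      by (rule convex_on_subset) auto
    from convex_on_add[OF cv1 this]
    have cv2: "convex_on {0..1} (\<lambda>s. J u v s + Q + lam / 2 * s * (1 - s) + M / 2 * s\<^sup>2)"
      by (simp add: algebra_simps)
    have "0 \<le> c + (M - lam)"
    proof (rule convex_on_second_derivative_nonneg[OF cv2 r])
      show "((\<lambda>s. J u v s + Q + lam / 2 * s * (1 - s) + M / 2 * s\<^sup>2) has_real_derivative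
          J' s + (lam / 2 * (1 - 2 * s) + M * s)) (at s)" if "\<bar>s\<bar> < r" for s
        by (rule J'[OF that] derivative_eq_intros refl)+ (simp add: field_simps)
      show "((\<lambda>s. J' s + (lam / 2 * (1 - 2 * s) + M * s)) has_real_derivative c + (M - lam)) (at 0)"
        by (rule J'' derivative_eq_intros refl)+ simp
    qed
    with c show False by simp
  qed
  \<comment> \<open>The constant \<open>C = 1\<close> suffices, since the construction reaches any
    prescribed bound, here \<open>\<omega> - 1\<close>.\<close>
  moreover have "\<exists>u v :: real ^ 'd \<Rightarrow> real.
       u \<in> density_P2 \<and> smooth_on UNIV u \<and> v \<in> density_P2 \<and> smooth_on UNIV v \<and>
       (\<forall>s\<ge>0. integrable lborel (\<lambda>x. H F G h \<epsilon> (push_forward (\<lambda>x. x + s *\<^sub>R e) u x) (v x))) \<and>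
       (\<exists>c. has_second_derivative_within (J u v) c 0 {0..} \<and> c \<le> - 1 * (\<omega> - 1))" for \<omega> :: real
  proof -
    obtain u v R r c J' where
      uv: "u \<in> density_P2" "v \<in> density_P2" "smooth_on UNIV u" "smooth_on UNIV v" and r: "0 < r" and
      J': "\<And>s. \<bar>s\<bar> < r \<Longrightarrow> (J u v has_real_derivative J' s) (at s)" and
      J'': "(J' has_real_derivative c) (at 0)" and c: "c \<le> - (\<omega> - 1)" and
      int: "\<And>s. integrable lborel (\<lambda>x. H F G h \<epsilon> (push_forward (\<lambda>x. x + s *\<^sub>R e) u x) (v x))"
      using ex[of "\<omega> - 1"] by blast
    have "has_second_derivative_within (J u v) c 0 {0..}"
      unfolding has_second_derivative_within_def
      using r J' J'' by (intro exI[of _ J'] exI[of _ r]) (auto intro: has_field_derivative_at_within)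
    then show ?thesis using uv c int by (intro exI[of _ u] exI[of _ v]) auto
  qed
  ultimately show ?thesis
    unfolding Let_def J_def e_def by (intro conjI exI[of _ 1] allI impI) auto
qed

end
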